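(* For every tree poset $P$ of height $k$, every real $\varepsilon>0$ and every positive integer $\ell$ there exists $\delta=\delta(\varepsilon,P,\ell)>0$ such that the following holds. Let $n$ be sufficiently large and let $\mathcal{F}\subseteq\widetilde{\mathcal{B}}_n$ be an $\ell$-gapped family with $|\mathcal{F}|\geq(k-1+\varepsilon)\binom{n}{\lfloor n/2\rfloor}$. Then there is a collection $\mathcal{H}$ of induced copies of $P$ in $\mathcal{F}$ satisfying 1. $|\mathcal{H}|\geq\delta^{|P|}n^{\ell(|P|-1)}\binom{n}{\lfloor n/2\rfloor}$; 2. $\Delta_j(\mathcal{H})\le(\delta n^{\ell})^{|P|-j}$ for all $1\le j\le|P|$.
   Context: $\widetilde{\mathcal{B}}_n=\{F\subseteq[n]: |\,|F|-n/2\,|<2\sqrt{n\ln n}\}$. A tree poset is a finite poset whose Hasse diagram is a tree; height is the largest number of elements in a chain; $|P|$ is the number of elements. An induced copy of $P$ in $\mathcal{F}$ is a subfamily that is the image of an injective map $f:P\to\mathcal{F}$ with $f(x)\subsetneq f(y)$ iff $x<_P y$. $\mathcal{F}$ is $\ell$-gapped if $|G\setminus F|\ge\ell$ whenever $F,G\in\mathcal{F}$, $F\subsetneq G$. A collection $\mathcal{H}$ of induced copies is viewed as a $|P|$-uniform hypergraph on vertex set $\mathcal{F}$ whose edges are the member-sets of the copies; for $\mathcal{D}\subseteq\mathcal{F}$, $\deg_{\mathcal{H}}(\mathcal{D})$ is the number of edges containing $\mathcal{D}$, and $\Delta_j(\mathcal{H})=\max_{|\mathcal{D}|=j}\deg_{\mathcal{H}}(\mathcal{D})$.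 *)

theory Defs
  imports Complex_Main
begin

definition strict_poset_on :: "'p set \<Rightarrow> ('p \<Rightarrow> 'p \<Rightarrow> bool) \<Rightarrow> bool" where
  "strict_poset_on V lt \<longleftrightarrow> finite V \<and>
     (\<forall>x\<in>V. \<not> lt x x) \<and>
     (\<forall>x\<in>V. \<forall>y\<in>V. \<forall>z\<in>V. lt x y \<longrightarrow> lt y z \<longrightarrow> lt x z)"

definition covers :: "'p set \<Rightarrow> ('p \<Rightarrow> 'p \<Rightarrow> bool) \<Rightarrow> 'p \<Rightarrow> 'p \<Rightarrow> bool" where
  "covers V lt x y \<longleftrightarrow> x \<in> V \<and> y \<in> V \<and> lt x y \<and> \<not> (\<exists>z\<in>V. lt x z \<and> lt z y)"

definition hasse_adj :: "'p set \<Rightarrow> ('p \<Rightarrow> 'p \<Rightarrow> bool) \<Rightarrow> 'p \<Rightarrow> 'p \<Rightarrow> bool" where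
  "hasse_adj V lt x y \<longleftrightarrow> covers V lt x y \<or> covers V lt y x"

definition hasse_connected :: "'p set \<Rightarrow> ('p \<Rightarrow> 'p \<Rightarrow> bool) \<Rightarrow> bool" where
  "hasse_connected V lt \<longleftrightarrow> V \<noteq> {} \<and>
     (\<forall>x\<in>V. \<forall>y\<in>V. (hasse_adj V lt)\<^sup>*\<^sup>* x y)"

definition hasse_acyclic :: "'p set \<Rightarrow> ('p \<Rightarrow> 'p \<Rightarrow> bool) \<Rightarrow> bool" where
  "hasse_acyclic V lt \<longleftrightarrow> \<not> (\<exists>cs. length cs \<ge> 3 \<and> distinct cs \<and> set cs \<subseteq> V \<and>
      (\<forall>i < length cs - 1. hasse_adj V lt (cs ! i) (cs ! Suc i)) \<and>
      hasse_adj V lt (last cs) (hd cs))"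

definition tree_poset :: "'p set \<Rightarrow> ('p \<Rightarrow> 'p \<Rightarrow> bool) \<Rightarrow> bool" where
  "tree_poset V lt \<longleftrightarrow> strict_poset_on V lt \<and> hasse_connected V lt \<and> hasse_acyclic V lt"

definition is_chain :: "'p set \<Rightarrow> ('p \<Rightarrow> 'p \<Rightarrow> bool) \<Rightarrow> 'p set \<Rightarrow> bool" where
  "is_chain V lt C \<longleftrightarrow> C \<subseteq> V \<and> (\<forall>x\<in>C. \<forall>y\<in>C. x = y \<or> lt x y \<or> lt y x)"

definition height :: "'p set \<Rightarrow> ('p \<Rightarrow> 'p \<Rightarrow> bool) \<Rightarrow> nat" where
  "height V lt = Max {card C | C. is_chain V lt C}"

definition Btilde :: "nat \<Rightarrow> nat set set" where
  "Btilde n = {F. F \<subseteq> {1..n} \<and> \<bar>real (card F) - real n / 2\<bar> < 2 * sqrt (real n * ln (real n))}"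

definition gapped :: "nat \<Rightarrow> nat set set \<Rightarrow> bool" where
  "gapped l \<F> \<longleftrightarrow> (\<forall>F\<in>\<F>. \<forall>G\<in>\<F>. F \<subset> G \<longrightarrow> card (G - F) \<ge> l)"

definition induced_copy :: "'p set \<Rightarrow> ('p \<Rightarrow> 'p \<Rightarrow> bool) \<Rightarrow> nat set set \<Rightarrow> nat set set \<Rightarrow> bool" where
  "induced_copy V lt \<F> h \<longleftrightarrow> (\<exists>f. inj_on f V \<and> f ` V \<subseteq> \<F> \<and> h = f ` V \<and>
     (\<forall>x\<in>V. \<forall>y\<in>V. f x \<subset> f y \<longleftrightarrow> lt x y))"

definition hdeg :: "nat set set set \<Rightarrow> nat set set \<Rightarrow> nat" where
  "hdeg H D = card {h \<in> H. D \<subseteq> h}"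

end

theory Submission
  imports Defs "HOL-Combinatorics.Multiset_Permutations"
begin

text \<open>
  Take a largest collection \<open>H\<close> of induced copies meeting the degree bounds with
  \<open>\<Delta> = \<delta> n\<^sup>l\<close>, and call a set of vertices saturated if its degree cannot grow. If \<open>H\<close> is too small,
  few single vertices are saturated, and discarding them keeps more than \<open>height - 1\<close> members of the
  family on an average maximal chain. Mark \<open>height\<close> consecutive members on each chain in all
  possible ways and prune the markings until every vertex still used at some level lies in a
  constant proportion of the chains through it. The tree is then embedded vertex by vertex: a new
  vertex \<open>y\<close> adjacent to an embedded \<open>x\<close> is read off a random marked chain through \<open>x\<close>.
  By gappedness each single \<open>y\<close> is hit with probability \<open>O(n\<^sup>-\<^sup>l)\<close>, so the \<open>O(\<Delta>)\<close> choices that complete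
  a saturated set cost only \<open>O(\<delta>)\<close>, while an unwanted comparability of \<open>y\<close> with another embedded
  vertex forces the chain to pick one of few elements early and has probability \<open>o(1)\<close>. The
  resulting copy contains no saturated set and enlarges \<open>H\<close>, a contradiction.
\<close>

section \<open>Maximal chains as permutations\<close>

text \<open>An ordering of \<open>U\<close> encodes the maximal chain of subsets that adds its
  entries one at a time; a uniform random maximal chain becomes a uniform permutation.\<close>

definition prefixes :: "'a list \<Rightarrow> 'a set set" where
  "prefixes xs = (\<lambda>i. set (take i xs)) ` {..length xs}"

text \<open>\<open>flags U x x\<close> serves as the sample space of chains through
  \<open>x\<close>. For \<open>x \<subseteq> y\<close>, the size of \<open>flags U x y\<close>
  relative to it is the conditional probability of meeting \<open>y\<close>.\<close>

definition flags :: "'a set \<Rightarrow> 'a set \<Rightarrow> 'a set \<Rightarrow> 'a list set" where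
  "flags U x y = {xs \<in> permutations_of_set U. x \<in> prefixes xs \<and> y \<in> prefixes xs}"

text \<open>Distinctness gives the initial segment of length \<open>i\<close> exactly
  \<open>i\<close> elements, so a set can occur on a chain only at the position given by its
  cardinality.\<close>

lemma prefixes_iff:
  assumes "xs \<in> permutations_of_set U"
  shows "x \<in> prefixes xs \<longleftrightarrow> card x \<le> card U \<and> x = set (take (card x) xs)"
proof -
  have d: "distinct xs" and len: "length xs = card U"
    using assms by (auto simp: permutations_of_set_def distinct_card)
  have "card (set (take i xs)) = i" if "i \<le> length xs" for i
    using d that by (simp add: distinct_card)
  thus ?thesis
    unfolding prefixes_def using len by (auto simp: image_iff)
qed

lemma finite_flags [simp]: "finite U \<Longrightarrow> finite (flags U x y)"
  by (rule finite_subset[of _ "permutations_of_set U"]) (auto simp: flags_def)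

text \<open>Cutting at positions \<open>card x\<close> and \<open>card y\<close> leaves independent
  orderings of \<open>x\<close>, \<open>y - x\<close> and \<open>U - y\<close>.\<close>

lemma flags_eq_image:
  assumes "finite U" "x \<subseteq> y" "y \<subseteq> U"
  shows "flags U x y = (\<lambda>(u, v, w). u @ v @ w) `
    (permutations_of_set x \<times> permutations_of_set (y - x) \<times> permutations_of_set (U - y))"
proof (intro equalityI subsetI)
  fix xs assume "xs \<in> flags U x y"
  hence xs: "xs \<in> permutations_of_set U" and px: "x \<in> prefixes xs" and py: "y \<in> prefixes xs"
    by (auto simp: flags_def)
  have d: "distinct xs" and s: "set xs = U" using xs by (auto simp: permutations_of_set_def)
  let ?a = "card x" and ?b = "card y"
  have x: "x = set (take ?a xs)" and y: "y = set (take ?b xs)"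
    using px py prefixes_iff[OF xs] by auto
  have ab: "?a \<le> ?b" using assms by (meson card_mono finite_subset)
  have tk: "take ?a (take ?b xs) = take ?a xs" using ab by (simp add: min_absorb1)
  have dt: "distinct (take ?b xs)" using d by simp
  have 1: "take ?a xs \<in> permutations_of_set x" using x d by (auto simp: permutations_of_set_def)
  have "set (take ?b xs) = set (take ?a (take ?b xs)) \<union> set (drop ?a (take ?b xs))"
    by (metis append_take_drop_id set_append)
  moreover have "set (take ?a (take ?b xs)) \<inter> set (drop ?a (take ?b xs)) = {}"
    using set_take_disj_set_drop_if_distinct[OF dt] by blast
  ultimately have "set (drop ?a (take ?b xs)) = y - x" using x y tk by auto
  hence 2: "drop ?a (take ?b xs) \<in> permutations_of_set (y - x)"
    using d by (auto simp: permutations_of_set_def)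
  have "set xs = set (take ?b xs) \<union> set (drop ?b xs)"
    by (metis append_take_drop_id set_append)
  moreover have "set (take ?b xs) \<inter> set (drop ?b xs) = {}"
    using set_take_disj_set_drop_if_distinct[OF d] by blast
  ultimately have "set (drop ?b xs) = U - y" using y s by auto
  hence 3: "drop ?b xs \<in> permutations_of_set (U - y)"
    using d by (auto simp: permutations_of_set_def)
  have "xs = take ?a xs @ drop ?a (take ?b xs) @ drop ?b xs"
    by (metis append.assoc append_take_drop_id tk)
  thus "xs \<in> (\<lambda>(u, v, w). u @ v @ w) `
    (permutations_of_set x \<times> permutations_of_set (y - x) \<times> permutations_of_set (U - y))"
    using 1 2 3 by (intro image_eqI[of _ _ "(take ?a xs, drop ?a (take ?b xs), drop ?b xs)"]) auto
next
  fix xs assume "xs \<in> (\<lambda>(u, v, w). u @ v @ w) `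
    (permutations_of_set x \<times> permutations_of_set (y - x) \<times> permutations_of_set (U - y))"
  then obtain u v w where xs: "xs = u @ v @ w" and
    u: "set u = x" "distinct u" and v: "set v = y - x" "distinct v" and
    w: "set w = U - y" "distinct w"
    by (auto simp: permutations_of_set_def)
  have "xs \<in> permutations_of_set U" using u v w xs assms by (auto simp: permutations_of_set_def)
  moreover have "x \<in> prefixes xs"
    unfolding prefixes_def using xs u by (intro image_eqI[of _ _ "length u"]) auto
  moreover have "y \<in> prefixes xs"
    unfolding prefixes_def using xs u v assms
    by (intro image_eqI[of _ _ "length (u @ v)"]) auto
  ultimately show "xs \<in> flags U x y" by (simp add: flags_def)
qed

section \<open>Probability that a uniform chain through \<open>x\<close> meets a given set\<close>

lemma card_flags:
  assumes "finite U" "x \<subseteq> y" "y \<subseteq> U"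
  shows "card (flags U x y) = fact (card x) * fact (card y - card x) * fact (card U - card y)"
proof -
  have fin: "finite x" "finite y" using assms by (meson finite_subset)+
  have "inj_on (\<lambda>(u, v, w). u @ v @ w)
    (permutations_of_set x \<times> permutations_of_set (y - x) \<times> permutations_of_set (U - y))"
    by (rule inj_onI) (auto dest!: length_finite_permutations_of_set)
  thus ?thesis
    using assms fin
    by (simp add: flags_eq_image[OF assms] card_image card_cartesian_product card_Diff_subset)
qed

text \<open>Given \<open>x\<close>, the set reached at size \<open>card y\<close> is uniform among
  the supersets of \<open>x\<close> of that size; the product form avoids division of
  naturals.\<close>

lemma card_flags_choose:
  assumes "finite U" "x \<subseteq> y" "y \<subseteq> U"
  shows "card (flags U x y) * ((card U - card x) choose (card y - card x)) = card (flags U x x)"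
proof -
  have le: "card x \<le> card y" "card y \<le> card U"
    using assms by (meson card_mono finite_subset)+
  have "fact (card y - card x) * fact ((card U - card x) - (card y - card x)) *
      ((card U - card x) choose (card y - card x)) = fact (card U - card x)"
    by (rule binomial_fact_lemma) (use le in auto)
  moreover have "(card U - card x) - (card y - card x) = card U - card y" using le by simp
  ultimately show ?thesis
    using assms by (simp add: card_flags mult.assoc)
qed

lemma card_flags_insert:
  assumes "finite U" "x \<subseteq> U" "a \<in> U - x"
  shows "real (card (flags U x (insert a x))) = card (flags U x x) / (real (card U) - card x)"
proof -
  have fx: "finite x" using assms finite_subset by blast
  have lt: "card x < card U" using assms by (intro psubset_card_mono) auto
  have "card (flags U x (insert a x)) * ((card U - card x) choose 1) = card (flags U x x)"
    using card_flags_choose[of U x "insert a x"] assms fx by (auto split: if_splits)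
  hence "real (card (flags U x (insert a x))) * (real (card U) - card x) = card (flags U x x)"
    using lt by (metis choose_one of_nat_diff of_nat_mult less_imp_le)
  thus ?thesis using lt by (simp add: field_simps)
qed

text \<open>The index \<open>d\<close> keeps distance \<open>l\<close> from both ends of the row, so
  unimodality and symmetry reduce the bound to \<open>d = l\<close>.\<close>

lemma choose_ge_power:
  assumes "l \<ge> 1" "l \<le> d" "d + l \<le> N"
  shows "(real N / real l) ^ l \<le> real (N choose d)"
proof -
  have "(N choose l) \<le> (N choose d)"
  proof (cases "2 * d \<le> N")
    case True thus ?thesis using assms by (intro binomial_mono) auto
  next
    case False
    have "(N choose l) \<le> (N choose (N - d))" using assms False by (intro binomial_mono) auto
    thus ?thesis using assms binomial_symmetric[of d N] by simp
  qed
  moreover have "(real N / real l) ^ l \<le> real (N choose l)"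
    using assms by (intro binomial_ge_n_over_k_pow_k) auto
  ultimately show ?thesis by linarith
qed

text \<open>Here a gap of \<open>l\<close> becomes a probability of order \<open>n^-l\<close>. The
  condition \<open>card y + l \<le> card U\<close> keeps the binomial index away from the upper end,
  where the coefficient is small again.\<close>

lemma card_flags_le:
  assumes "finite U" "x \<subseteq> y" "y \<subseteq> U" "l \<ge> 1" "l \<le> card (y - x)" "card y + l \<le> card U"
  shows "real (card (flags U x y)) \<le> (real l / (real (card U) - card x)) ^ l * card (flags U x x)"
proof -
  have fin: "finite x" "finite y" using assms by (meson finite_subset)+
  have le: "card x \<le> card y" using assms fin by (simp add: card_mono)
  have d: "card (y - x) = card y - card x" using assms fin by (simp add: card_Diff_subset)
  let ?N = "card U - card x"
  have pos: "real (card U) - card x > 0" using assms le d by linarith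
  have N: "real ?N = real (card U) - card x" using assms le by (simp add: of_nat_diff)
  have "(real ?N / real l) ^ l \<le> real (?N choose (card y - card x))"
    using assms d le by (intro choose_ge_power) auto
  hence "real (card (flags U x y)) * (real ?N / real l) ^ l \<le> card (flags U x x)"
    using card_flags_choose[OF assms(1-3)]
    by (metis mult_left_mono of_nat_0_le_iff of_nat_mult)
  hence "(real l / real ?N) ^ l * (real (card (flags U x y)) * (real ?N / real l) ^ l)
      \<le> (real l / real ?N) ^ l * card (flags U x x)"
    by (rule mult_left_mono) simp
  moreover have "(real l / real ?N) ^ l * (real ?N / real l) ^ l = 1"
    using pos N assms(4) by (simp add: power_mult_distrib[symmetric])
  hence "(real l / real ?N) ^ l * (real (card (flags U x y)) * (real ?N / real l) ^ l)
      = real (card (flags U x y))"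
    by (simp only: mult.left_commute[of _ "real (card (flags U x y))"] mult_1_right)
  ultimately show ?thesis
    unfolding N by simp
qed

text \<open>The first element that the chain adds after \<open>x\<close> already lies in
  \<open>y\<close>; this turns ending up inside a set \<open>z\<close> into a union over few
  possible next elements.\<close>

lemma prefix_Suc:
  assumes "xs \<in> permutations_of_set U" "x \<in> prefixes xs" "y \<in> prefixes xs" "x \<subset> y" "finite U"
  shows "\<exists>a\<in>y - x. insert a x \<in> prefixes xs"
proof -
  have x: "x = set (take (card x) xs)" and y: "y = set (take (card y) xs)" and yU: "card y \<le> card U"
    using prefixes_iff[OF assms(1)] assms by auto
  have len: "length xs = card U" and d: "distinct xs"
    using assms(1) by (auto simp: permutations_of_set_def distinct_card)
  have "finite y" by (metis y finite_set)
  hence lt: "card x < card y" using assms by (simp add: psubset_card_mono)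
  let ?a = "xs ! card x"
  have ins: "insert ?a x = set (take (Suc (card x)) xs)"
    using lt yU len by (subst (2) x) (simp add: take_Suc_conv_app_nth)
  have "?a \<in> y" using lt yU len by (subst y) (auto simp: in_set_conv_nth)
  moreover have "?a \<notin> x"
    using lt yU len d by (subst (2) x) (auto simp: in_set_conv_nth nth_eq_iff_index_eq)
  moreover have "insert ?a x \<in> prefixes xs"
    unfolding prefixes_def ins using lt yU len by auto
  ultimately show ?thesis by blast
qed

text \<open>Exchanging the entries at positions \<open>p\<close> and \<open>card x\<close> shows that \<open>b\<close> is equally likely at each
  position after the initial segment \<open>x\<close>.\<close>

lemma card_nth_eq_le:
  assumes "finite U" "x \<subseteq> U" "b \<in> U - x" "card x \<le> p" "p < card U"
  shows "card {xs \<in> flags U x x. xs ! p = b} \<le> card (flags U x (insert b x))"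
proof (rule card_inj_on_le)
  let ?q = "card x"
  let ?sw = "\<lambda>xs. xs[?q := xs ! p, p := xs ! ?q]"
  show "inj_on ?sw {xs \<in> flags U x x. xs ! p = b}"
  proof (rule inj_onI)
    fix xs ys assume xs: "xs \<in> {xs \<in> flags U x x. xs ! p = b}"
      and ys: "ys \<in> {xs \<in> flags U x x. xs ! p = b}" and eq: "?sw xs = ?sw ys"
    have l: "length xs = card U" "length ys = card U"
      using xs ys by (auto simp: flags_def length_finite_permutations_of_set)
    \<comment> \<open>The exchange is an involution, also for \<open>p = card x\<close>, where it
      changes nothing.\<close>
    have "?sw (?sw xs) = xs" "?sw (?sw ys) = ys" using assms l
      by (auto intro!: nth_equalityI simp: nth_list_update)
    thus "xs = ys" using eq by metis
  qed
  show "?sw ` {xs \<in> flags U x x. xs ! p = b} \<subseteq> flags U x (insert b x)"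
  proof (rule image_subsetI)
    fix xs assume a: "xs \<in> {xs \<in> flags U x x. xs ! p = b}"
    hence xs: "xs \<in> permutations_of_set U" and px: "x \<in> prefixes xs" and b: "xs ! p = b"
      by (auto simp: flags_def)
    have len: "length xs = card U" by (rule length_finite_permutations_of_set[OF xs])
    have x: "x = set (take ?q xs)" using prefixes_iff[OF xs] px by auto
    have "mset (?sw xs) = mset xs" using assms len by (intro mset_swap) auto
    hence sw: "?sw xs \<in> permutations_of_set U"
      using xs by (auto simp: permutations_of_set_def dest: mset_eq_setD mset_eq_imp_distinct_iff)
    have t: "take ?q (?sw xs) = take ?q xs" using assms by simp
    have 1: "x \<in> prefixes (?sw xs)"
      unfolding prefixes_def using x t assms len by (intro image_eqI[of _ _ ?q]) auto
    have n: "?sw xs ! ?q = b" using assms len b by (cases "p = ?q") auto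
    have "insert b x = set (take (Suc ?q) (?sw xs))"
      using assms len x t n by (subst take_Suc_conv_app_nth) auto
    hence 2: "insert b x \<in> prefixes (?sw xs)"
      unfolding prefixes_def using assms len by (intro image_eqI[of _ _ "Suc ?q"]) auto
    show "?sw xs \<in> flags U x (insert b x)" using sw 1 2 by (simp add: flags_def)
  qed
qed (use assms in auto)

section \<open>Chains through a single set, and random steps upwards\<close>

lemma card_flags_pos:
  assumes "finite U" "x \<subseteq> U"
  shows "card (flags U x x) > 0"
  using assms by (simp add: card_flags)

text \<open>The LYM weight: a set of size \<open>j\<close> lies on \<open>fact n\<close> divided by
  \<open>n choose j\<close> chains, where \<open>n = card U\<close>, and the middle coefficient is
  the largest.\<close>

lemma card_flags_ge:
  assumes "finite U" "x \<subseteq> U"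
  shows "fact (card U) \<le> card (flags U x x) * (card U choose (card U div 2))"
proof -
  have le: "card x \<le> card U" using assms by (simp add: card_mono)
  have "card (flags U x x) * (card U choose card x) = fact (card U)"
    using assms le by (simp add: card_flags binomial_fact_lemma)
  moreover have "(card U choose card x) \<le> (card U choose (card U div 2))"
    by (rule binomial_maximum)
  ultimately show ?thesis by (metis mult_le_mono2)
qed

text \<open>A union bound over chains through \<open>x\<close>, of which a proportion
  \<open>c\<close> is usable. With \<open>q = card U - card x\<close>, each member of
  \<open>B\<close> is met with probability at most \<open>(l / q) ^ l\<close>. A \<open>z\<close>
  above \<open>g xs\<close> forces the very next element of the chain into \<open>z - x\<close>; a
  \<open>z\<close> below \<open>g xs\<close> but not below \<open>x\<close> forces a fixed element
  of \<open>z - x\<close> into the next \<open>s\<close> positions. Either event costs at most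
  \<open>s / q\<close> per \<open>z\<close>.\<close>

lemma chain_step_up:
  fixes g :: "'a list \<Rightarrow> 'a set" and c :: real
  assumes U: "finite U" "x \<subseteq> U"
    and W: "W \<subseteq> flags U x x" "c * card (flags U x x) \<le> card W"
    and g: "\<And>xs. xs \<in> W \<Longrightarrow> g xs \<in> prefixes xs \<and> x \<subset> g xs \<and> l \<le> card (g xs - x)
      \<and> card (g xs) \<le> card x + s \<and> card (g xs) + l \<le> card U"
    and Z: "finite Z" "\<And>z. z \<in> Z \<Longrightarrow> z \<subseteq> U \<and> card z \<le> card x + s"
    and B: "finite B" and l: "l \<ge> 1"
    and bound: "card B * (l / (real (card U) - card x)) ^ l
      + 2 * real (card Z) * (s / (real (card U) - card x)) < c"
  shows "\<exists>xs\<in>W. g xs \<notin> B \<and> (\<forall>z\<in>Z. \<not> g xs \<subseteq> z \<and> (z \<subseteq> g xs \<longrightarrow> z \<subseteq> x))"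
proof (rule ccontr)
  assume neg: "\<not> ?thesis"
  define N where "N = real (card (flags U x x))"
  define q where "q = real (card U) - card x"
  have N: "N > 0" using card_flags_pos[OF U] by (simp add: N_def)
  have fx: "finite x" using U finite_subset by blast
  have xU: "card x \<le> card U" using U by (simp add: card_mono)
  hence q: "q \<ge> 0" by (simp add: q_def)
  have perm: "xs \<in> permutations_of_set U" "x \<in> prefixes xs" if "xs \<in> flags U x x" for xs
    using that by (auto simp: flags_def)
  \<comment> \<open>One element of \<open>z\<close> outside \<open>x\<close> suffices as a witness:
    if \<open>z \<subseteq> g xs\<close>, the chain must add it before reaching
    \<open>g xs\<close>.\<close>
  define b where "b z = (SOME b. b \<in> z - x)" for z
  have b: "b z \<in> z - x" if "\<not> z \<subseteq> x" for z
    using that unfolding b_def by (metis Diff_iff some_in_eq subsetI empty_iff)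
  \<comment> \<open>Only the members of \<open>B\<close> that \<open>g\<close> can return matter,
    and to these \<open>card_flags_le\<close> applies.\<close>
  define B' where "B' = {y \<in> B. x \<subset> y \<and> y \<subseteq> U \<and> l \<le> card (y - x) \<and> card y + l \<le> card U}"
  \<comment> \<open>Since \<open>x \<subset> g xs\<close>, only a \<open>z\<close> containing
    \<open>x\<close> can contain \<open>g xs\<close>, and then \<open>z - x\<close> has at most
    \<open>s\<close> elements.\<close>
  define Z1 where "Z1 = {z \<in> Z. x \<subseteq> z}"
  define Z2 where "Z2 = {z \<in> Z. \<not> z \<subseteq> x}"
  \<comment> \<open>Indices of the entries added between \<open>x\<close> and \<open>g xs\<close>;
    counting from 0, the first entry after \<open>x\<close> has index \<open>card x\<close>.\<close>
  define P where "P = {p. card x \<le> p \<and> p < card x + s \<and> p < card U}"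
  define WB where "WB = (\<Union>y\<in>B'. flags U x y)"
  define W1 where "W1 = (\<Union>z\<in>Z1. \<Union>a\<in>z - x. flags U x (insert a x))"
  define W2 where "W2 = (\<Union>z\<in>Z2. \<Union>p\<in>P. {xs \<in> flags U x x. xs ! p = b z})"
  have "W \<subseteq> WB \<union> (W1 \<union> W2)"
  proof
    fix xs assume xs: "xs \<in> W"
    have px: "xs \<in> permutations_of_set U" "x \<in> prefixes xs" "xs \<in> flags U x x"
      using W perm xs by auto
    have gx: "g xs \<in> prefixes xs" "x \<subset> g xs" "l \<le> card (g xs - x)"
      "card (g xs) \<le> card x + s" "card (g xs) + l \<le> card U"
      using g[OF xs] by auto
    have gt: "g xs = set (take (card (g xs)) xs)" "card (g xs) \<le> card U"
      using prefixes_iff[OF px(1)] gx by auto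
    have gU: "g xs \<subseteq> U"
      using gt(1) px(1) by (metis permutations_of_setD(1) set_take_subset)
    have "\<not> (g xs \<notin> B \<and> (\<forall>z\<in>Z. \<not> g xs \<subseteq> z \<and> (z \<subseteq> g xs \<longrightarrow> z \<subseteq> x)))"
      by (rule notI, rule notE[OF neg], rule bexI[OF _ xs])
    then consider "g xs \<in> B" | z where "z \<in> Z" "g xs \<subseteq> z"
      | z where "z \<in> Z" "z \<subseteq> g xs" "\<not> z \<subseteq> x"
      by metis
    thus "xs \<in> WB \<union> (W1 \<union> W2)"
    proof cases
      case 1
      hence "g xs \<in> B'" using gx gU by (auto simp: B'_def)
      moreover have "xs \<in> flags U x (g xs)" using px gx by (auto simp: flags_def)
      ultimately show ?thesis by (auto simp: WB_def)
    next
      case 2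
      obtain a where "a \<in> g xs - x" "insert a x \<in> prefixes xs"
        using prefix_Suc[OF px(1,2) gx(1,2) U(1)] by blast
      hence "a \<in> z - x" "xs \<in> flags U x (insert a x)" "z \<in> Z1"
        using 2 px gx by (auto simp: flags_def Z1_def)
      thus ?thesis by (auto simp: W1_def)
    next
      case 3
      have bz: "b z \<in> z - x" using b 3 by blast
      have len: "length xs = card U" by (rule length_finite_permutations_of_set[OF px(1)])
      have "b z \<in> set (take (card (g xs)) xs)" using bz 3 gt by blast
      then obtain p where p: "p < card (g xs)" "p < card U" "xs ! p = b z"
        by (auto simp: in_set_conv_nth len)
      have "card x \<le> p"
      proof (rule ccontr)
        assume "\<not> card x \<le> p"
        hence "xs ! p \<in> set (take (card x) xs)"
          using p len by (auto simp: in_set_conv_nth intro!: exI[of _ p])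
        thus False using p bz prefixes_iff[OF px(1)] px(2) by auto
      qed
      hence "p \<in> P" using p gx by (auto simp: P_def)
      moreover have "z \<in> Z2" using 3 by (auto simp: Z2_def)
      ultimately show ?thesis using px p by (auto simp: W2_def)
    qed
  qed
  moreover have fin: "finite Z1" "finite Z2" "finite B'" "finite P"
    using Z B by (auto simp: Z1_def Z2_def B'_def P_def)
  have finz: "finite z" if "z \<in> Z" for z using Z(2)[OF that] U finite_subset by blast
  have "finite (WB \<union> (W1 \<union> W2))"
    using fin U finz by (auto simp: WB_def W1_def W2_def Z1_def)
  ultimately have "card W \<le> card (WB \<union> (W1 \<union> W2))" by (intro card_mono)
  also have "\<dots> \<le> card WB + (card W1 + card W2)"
    by (meson add_left_mono card_Un_le le_trans)
  finally have "real (card W) \<le> card WB + (real (card W1) + card W2)" by linarith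
  also have "real (card WB) \<le> card B * ((l / q) ^ l * N)"
  proof -
    have "real (card WB) \<le> real (\<Sum>y\<in>B'. card (flags U x y))"
      unfolding WB_def using card_UN_le[OF fin(3)] of_nat_mono by blast
    also have "\<dots> \<le> (\<Sum>y\<in>B'. (l / q) ^ l * N)"
      unfolding of_nat_sum N_def q_def
      using U l by (intro sum_mono card_flags_le) (auto simp: B'_def)
    also have "\<dots> = card B' * ((l / q) ^ l * N)" by simp
    also have "\<dots> \<le> card B * ((l / q) ^ l * N)"
      using q N B by (intro mult_right_mono of_nat_mono card_mono) (auto simp: B'_def)
    finally show ?thesis .
  qed
  also have "real (card W1) \<le> card Z * (s * (N / q))"
  proof -
    have "card W1 \<le> (\<Sum>z\<in>Z1. card (\<Union>a\<in>z - x. flags U x (insert a x)))"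
      unfolding W1_def using card_UN_le[OF fin(1)] .
    also have "\<dots> \<le> (\<Sum>z\<in>Z1. \<Sum>a\<in>z - x. card (flags U x (insert a x)))"
      using finz by (intro sum_mono card_UN_le) (auto simp: Z1_def)
    finally have "real (card W1) \<le> (\<Sum>z\<in>Z1. \<Sum>a\<in>z - x. real (card (flags U x (insert a x))))"
      by (metis (mono_tags, lifting) of_nat_mono of_nat_sum sum.cong)
    also have "\<dots> = (\<Sum>z\<in>Z1. \<Sum>a\<in>z - x. N / q)"
      using Z U unfolding N_def q_def
      by (intro sum.cong card_flags_insert refl) (auto simp: Z1_def)
    also have "\<dots> \<le> (\<Sum>z\<in>Z1. s * (N / q))"
    proof (rule sum_mono)
      fix z assume "z \<in> Z1"
      hence "card (z - x) \<le> s"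
        using Z(2)[of z] finz[of z] fx by (auto simp: Z1_def card_Diff_subset)
      thus "(\<Sum>a\<in>z - x. N / q) \<le> s * (N / q)"
        using N q by (simp add: mult_right_mono divide_right_mono)
    qed
    also have "\<dots> = card Z1 * (s * (N / q))" by simp
    also have "\<dots> \<le> card Z * (s * (N / q))"
      using q N Z by (intro mult_right_mono of_nat_mono card_mono) (auto simp: Z1_def)
    finally show ?thesis .
  qed
  also have "real (card W2) \<le> card Z * (s * (N / q))"
  proof -
    have "card W2 \<le> (\<Sum>z\<in>Z2. card (\<Union>p\<in>P. {xs \<in> flags U x x. xs ! p = b z}))"
      unfolding W2_def using card_UN_le[OF fin(2)] .
    also have "\<dots> \<le> (\<Sum>z\<in>Z2. \<Sum>p\<in>P. card {xs \<in> flags U x x. xs ! p = b z})"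
      using fin by (intro sum_mono card_UN_le)
    also have "\<dots> \<le> (\<Sum>z\<in>Z2. \<Sum>p\<in>P. card (flags U x (insert (b z) x)))"
      using U b Z(2) by (intro sum_mono card_nth_eq_le) (auto simp: Z2_def P_def)
    finally have "real (card W2) \<le> (\<Sum>z\<in>Z2. \<Sum>p\<in>P. real (card (flags U x (insert (b z) x))))"
      by (metis (mono_tags, lifting) of_nat_mono of_nat_sum sum.cong)
    also have "\<dots> = (\<Sum>z\<in>Z2. \<Sum>p\<in>P. N / q)"
      using Z b U unfolding N_def q_def
      by (intro sum.cong card_flags_insert refl) (auto simp: Z2_def)
    also have "\<dots> \<le> (\<Sum>z\<in>Z2. s * (N / q))"
    proof (rule sum_mono)
      have "card P \<le> card {card x..<card x + s}" by (intro card_mono) (auto simp: P_def)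
      hence "card P \<le> s" by simp
      thus "(\<Sum>p\<in>P. N / q) \<le> s * (N / q)"
        using N q by (simp add: mult_right_mono divide_right_mono)
    qed
    also have "\<dots> = card Z2 * (s * (N / q))" by simp
    also have "\<dots> \<le> card Z * (s * (N / q))"
      using q N Z by (intro mult_right_mono of_nat_mono card_mono) (auto simp: Z2_def)
    finally show ?thesis .
  qed
  finally have "real (card W) \<le> (card B * (l / q) ^ l + 2 * real (card Z) * (s / q)) * N"
    by (simp add: algebra_simps)
  also have "\<dots> < c * N" using bound N by (simp add: q_def)
  finally show False using W by (simp add: N_def)
qed

section \<open>Random steps downwards, by complementation\<close>

lemma prefixes_rev:
  assumes "xs \<in> permutations_of_set U"
  shows "prefixes (rev xs) = (\<lambda>x. U - x) ` prefixes xs"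
proof -
  have d: "distinct xs" and s: "set xs = U" using assms by (auto simp: permutations_of_set_def)
  have "set (take i (rev xs)) = U - set (take (length xs - i) xs)" for i
  proof -
    have "set (take i (rev xs)) = set (drop (length xs - i) xs)" by (simp add: take_rev)
    moreover have "U = set (take (length xs - i) xs) \<union> set (drop (length xs - i) xs)"
      using s by (metis append_take_drop_id set_append)
    moreover have "set (take (length xs - i) xs) \<inter> set (drop (length xs - i) xs) = {}"
      using set_take_disj_set_drop_if_distinct[OF d] by blast
    ultimately show ?thesis by auto
  qed
  hence "prefixes (rev xs) = (\<lambda>i. U - set (take (length xs - i) xs)) ` {..length xs}"
    unfolding prefixes_def by simp
  also have "\<dots> = (\<lambda>i. U - set (take i xs)) ` (\<lambda>i. length xs - i) ` {..length xs}"
    by (simp add: image_image)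
  also have "(\<lambda>i. length xs - i) ` {..length xs} = {..length xs}"
    by (auto simp: image_iff) (metis atMost_iff diff_diff_cancel diff_le_self)
  finally show ?thesis by (simp add: prefixes_def image_image)
qed

lemma rev_permutations_of_set:
  "rev xs \<in> permutations_of_set U \<longleftrightarrow> xs \<in> permutations_of_set U"
  by (simp add: permutations_of_set_def)

lemma rev_flags:
  assumes "xs \<in> flags U x x"
  shows "rev xs \<in> flags U (U - x) (U - x)"
  using assms by (auto simp: flags_def rev_permutations_of_set prefixes_rev)

text \<open>Reversing a list complements its chain, so this is the upward step at
  \<open>U - x\<close>. From there \<open>card x\<close> elements remain to be added, which explains
  the denominators.\<close>

lemma chain_step_down:
  fixes g :: "'a list \<Rightarrow> 'a set" and c :: real
  assumes U: "finite U" "x \<subseteq> U"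
    and W: "W \<subseteq> flags U x x" "c * card (flags U x x) \<le> card W"
    and g: "\<And>xs. xs \<in> W \<Longrightarrow> g xs \<in> prefixes xs \<and> g xs \<subset> x \<and> l \<le> card (x - g xs)
      \<and> card x \<le> card (g xs) + s \<and> l \<le> card (g xs)"
    and Z: "finite Z" "\<And>z. z \<in> Z \<Longrightarrow> z \<subseteq> U \<and> card x \<le> card z + s"
    and B: "finite B" and l: "l \<ge> 1"
    and bound: "card B * (l / real (card x)) ^ l + 2 * real (card Z) * (s / real (card x)) < c"
  shows "\<exists>xs\<in>W. g xs \<notin> B \<and> (\<forall>z\<in>Z. \<not> z \<subseteq> g xs \<and> (g xs \<subseteq> z \<longrightarrow> x \<subseteq> z))"
proof -
  let ?co = "\<lambda>y. U - y"
  have cardco: "card (?co y) = card U - card y" "card y \<le> card U" if "y \<subseteq> U" for y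
    using that U by (auto simp: card_Diff_subset finite_subset card_mono)
  have perm: "xs \<in> permutations_of_set U" if "xs \<in> W" for xs
    using that W by (auto simp: flags_def)
  have gU: "g xs \<subseteq> U" if "xs \<in> W" for xs using g[OF that] U by blast
  have "\<exists>xs\<in>rev ` W. ?co (g (rev xs)) \<notin> ?co ` B \<and>
    (\<forall>z\<in>?co ` Z. \<not> ?co (g (rev xs)) \<subseteq> z \<and> (z \<subseteq> ?co (g (rev xs)) \<longrightarrow> z \<subseteq> ?co x))"
  proof (rule chain_step_up[where s = s and l = l and c = c])
    show "finite U" "?co x \<subseteq> U" using U by auto
    show "rev ` W \<subseteq> flags U (?co x) (?co x)" using W rev_flags by blast
    have "card (flags U (?co x) (?co x)) = card (flags U x x)"
      using U cardco by (simp add: card_flags)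
    moreover have "card (rev ` W) = card W" by (simp add: card_image)
    ultimately show "c * card (flags U (?co x) (?co x)) \<le> card (rev ` W)" using W by simp
    show "?co (g (rev xs)) \<in> prefixes xs \<and> ?co x \<subset> ?co (g (rev xs)) \<and>
      l \<le> card (?co (g (rev xs)) - ?co x) \<and> card (?co (g (rev xs))) \<le> card (?co x) + s \<and>
      card (?co (g (rev xs))) + l \<le> card U" if xs: "xs \<in> rev ` W" for xs
    proof -
      obtain ys where ys: "ys \<in> W" "xs = rev ys" using xs by blast
      have 1: "?co (g ys) \<in> prefixes (rev ys)" unfolding prefixes_rev[OF perm[OF ys(1)]] using g[OF ys(1)] by blast
      have 2: "?co (g ys) - ?co x = x - g ys" using U by blast
      have "?co x \<subset> ?co (g ys)" using g[OF ys(1)] U gU[OF ys(1)] by blast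
      thus ?thesis using 1 2 g[OF ys(1)] ys cardco(1)[OF gU[OF ys(1)]] cardco(1)[OF U(2)]
          cardco(2)[OF gU[OF ys(1)]] cardco(2)[OF U(2)] by auto
    qed
    show "z \<subseteq> U \<and> card z \<le> card (?co x) + s" if z: "z \<in> ?co ` Z" for z
    proof -
      obtain w where w: "w \<in> Z" "z = ?co w" using z by blast
      show ?thesis using w Z(2)[OF w(1)] cardco[of w] cardco[of x] U by auto
    qed
    have le: "card (?co ` B) \<le> card B" "card (?co ` Z) \<le> card Z"
      using B Z by (auto intro: card_image_le)
    have q: "real (card U) - card (?co x) = card x" using cardco[OF U(2)] by simp
    have "card (?co ` B) * (l / real (card x)) ^ l + 2 * real (card (?co ` Z)) * (s / real (card x)) \<le>
      card B * (l / real (card x)) ^ l + 2 * real (card Z) * (s / real (card x))"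
      using le by (intro add_mono mult_right_mono) auto
    thus "card (?co ` B) * (l / (real (card U) - card (?co x))) ^ l +
      2 * real (card (?co ` Z)) * (s / (real (card U) - card (?co x))) < c"
      unfolding q using bound by simp
  qed (use B Z l in auto)
  then obtain xs where xs: "xs \<in> W" and nB: "?co (g xs) \<notin> ?co ` B"
    and nZ: "\<And>z. z \<in> Z \<Longrightarrow> \<not> ?co (g xs) \<subseteq> ?co z \<and> (?co z \<subseteq> ?co (g xs) \<longrightarrow> ?co z \<subseteq> ?co x)"
    by force
  have "\<not> z \<subseteq> g xs \<and> (g xs \<subseteq> z \<longrightarrow> x \<subseteq> z)" if "z \<in> Z" for z
    using nZ[OF that] U by blast
  thus ?thesis using xs nB by blast
qed

section \<open>Consecutive markings\<close>

text \<open>Fibres below their threshold are deleted one after another. Each pair of an index and a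
  key vanishes at most once, at a cost below its threshold, so the total loss stays below
  \<open>card C\<^sub>0\<close> and something survives.\<close>

lemma prune_small_fibers:
  fixes key :: "'i \<Rightarrow> 'a \<Rightarrow> 'b" and \<tau> :: "'b \<Rightarrow> real"
  assumes fin: "finite C\<^sub>0" "finite I" "finite F"
    and key: "\<And>i a. i \<in> I \<Longrightarrow> a \<in> C\<^sub>0 \<Longrightarrow> key i a \<in> F"
    and nonneg: "\<And>x. x \<in> F \<Longrightarrow> \<tau> x \<ge> 0"
    and less: "(\<Sum>i\<in>I. \<Sum>x\<in>F. \<tau> x) < card C\<^sub>0"
  shows "\<exists>C\<subseteq>C\<^sub>0. C \<noteq> {} \<and> (\<forall>i\<in>I. \<forall>a\<in>C. \<tau> (key i a) \<le> card {b \<in> C. key i b = key i a})"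
proof -
  define live where "live C = {p \<in> I \<times> F. \<exists>a\<in>C. key (fst p) a = snd p}" for C
  \<comment> \<open>A potential replaces the iteration: the thresholds of the nonempty fibres sum to
    less than the number of elements. Deleting a small fibre preserves this, so a set of least
    cardinality with the property has no small fibre.\<close>
  define P where "P C \<longleftrightarrow> C \<subseteq> C\<^sub>0 \<and> (\<Sum>p\<in>live C. \<tau> (snd p)) < card C" for C
  have finl: "finite (live C)" for C using fin by (auto simp: live_def)
  have "(\<Sum>p\<in>live C\<^sub>0. \<tau> (snd p)) \<le> (\<Sum>p\<in>I \<times> F. \<tau> (snd p))"
    using fin nonneg by (intro sum_mono2) (auto simp: live_def)
  also have "\<dots> = (\<Sum>i\<in>I. \<Sum>x\<in>F. \<tau> x)"
    by (subst sum.cartesian_product) (simp add: case_prod_unfold)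
  finally have "P C\<^sub>0" using less by (simp add: P_def)
  then obtain C where C: "P C" and min: "\<And>C'. P C' \<Longrightarrow> card C \<le> card C'"
    using ex_has_least_nat[of P C\<^sub>0 card] by blast
  have sub: "C \<subseteq> C\<^sub>0" using C by (simp add: P_def)
  have finC: "finite C" using sub fin finite_subset by blast
  have "(\<Sum>p\<in>live C. \<tau> (snd p)) \<ge> 0" using nonneg by (intro sum_nonneg) (auto simp: live_def)
  hence "C \<noteq> {}" using C by (auto simp: P_def)
  moreover have "\<tau> (key i a) \<le> card {b \<in> C. key i b = key i a}" if "i \<in> I" "a \<in> C" for i a
  proof (rule ccontr)
    let ?x = "key i a"
    let ?fib = "{b \<in> C. key i b = ?x}"
    assume small: "\<not> \<tau> ?x \<le> card ?fib"
    have mem: "(i, ?x) \<in> live C" using that sub key by (auto simp: live_def)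
    have "live (C - ?fib) \<subseteq> live C - {(i, ?x)}" by (auto simp: live_def)
    hence "(\<Sum>p\<in>live (C - ?fib). \<tau> (snd p)) \<le> (\<Sum>p\<in>live C - {(i, ?x)}. \<tau> (snd p))"
      using finl nonneg by (intro sum_mono2) (auto simp: live_def)
    also have "\<dots> = (\<Sum>p\<in>live C. \<tau> (snd p)) - \<tau> ?x"
      using mem finl by (simp add: sum_diff1)
    also have "\<dots> < real (card C) - card ?fib" using C small by (simp add: P_def)
    also have "\<dots> = card (C - ?fib)"
      using finC by (simp add: card_Diff_subset of_nat_diff card_mono)
    finally have "P (C - ?fib)" using sub by (auto simp: P_def)
    hence "card C \<le> card (C - ?fib)" by (rule min)
    moreover have "card (C - ?fib) < card C" using finC that by (intro psubset_card_mono) auto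
    ultimately show False by simp
  qed
  ultimately show ?thesis using sub by blast
qed

section \<open>Members of a family along a maximal chain\<close>

definition trace :: "'a set set \<Rightarrow> 'a list \<Rightarrow> 'a set list" where
  "trace F xs = filter (\<lambda>x. x \<in> F) (map (\<lambda>i. set (take i xs)) [0..<Suc (length xs)])"

lemma set_trace: "set (trace F xs) = F \<inter> prefixes xs"
  unfolding trace_def prefixes_def
  by (simp only: set_filter set_map set_upt) (auto simp: less_Suc_eq_le image_iff)

lemma sorted_trace:
  assumes "distinct xs"
  shows "sorted_wrt (\<subset>) (trace F xs)"
proof -
  have "sorted_wrt (<) [0..<Suc (length xs)]" by (rule sorted_wrt_upt)
  hence "sorted_wrt (\<lambda>i j. set (take i xs) \<subset> set (take j xs)) [0..<Suc (length xs)]"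
  proof (rule sorted_wrt_mono_rel[rotated])
    fix i j assume ij: "i \<in> set [0..<Suc (length xs)]" "j \<in> set [0..<Suc (length xs)]" "i < j"
    have "card (set (take i xs)) \<noteq> card (set (take j xs))"
      using assms ij by (auto simp: distinct_card min_def)
    thus "set (take i xs) \<subset> set (take j xs)"
      using set_take_subset_set_take[of i j xs] ij by auto
  qed
  thus ?thesis unfolding trace_def by (intro sorted_wrt_filter) (simp only: sorted_wrt_map)
qed

lemma trace_nth_psubset:
  assumes "distinct xs" "i < j" "j < length (trace F xs)"
  shows "trace F xs ! i \<subset> trace F xs ! j"
  using sorted_wrt_nth_less[OF sorted_trace[OF assms(1)] assms(2,3)] .

lemma trace_nth_inj:
  assumes "distinct xs" "i < length (trace F xs)" "j < length (trace F xs)"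
    "trace F xs ! i = trace F xs ! j"
  shows "i = j"
  using trace_nth_psubset[OF assms(1), of i j F] trace_nth_psubset[OF assms(1), of j i F] assms
  by (metis linorder_neqE_nat psubset_eq)

lemma length_trace:
  assumes "distinct xs"
  shows "length (trace F xs) = card (F \<inter> prefixes xs)"
proof -
  have "distinct (trace F xs)"
    using trace_nth_inj[OF assms] by (auto simp: distinct_conv_nth)
  thus ?thesis by (metis distinct_card set_trace)
qed

text \<open>A marking \<open>(xs, t)\<close> selects \<open>k\<close> \<^emph>\<open>consecutive\<close> members of \<open>F\<close> on the maximal chain of \<open>xs\<close>.
  Hence a chain has at most one marking with a given member at a given level, so that markings
  through a set are counted by the chains through it, however long the traces are.\<close>

lemma rich_levels:
  fixes e :: real
  assumes U: "finite U" "F \<subseteq> Pow U" and k: "k \<ge> 1" and e: "e > 0"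
    and large: "(real k - 1 + e) * (card U choose (card U div 2)) \<le> card F"
  shows "\<exists>G. (\<forall>i<k. G i \<noteq> {} \<and> G i \<subseteq> F) \<and>
    (\<forall>i<k. \<forall>j<k. i \<noteq> j \<longrightarrow> (\<forall>x\<in>G i. \<exists>W g. W \<subseteq> flags U x x \<and>
      e / (2 * real k * (real k - 1 + e)) * card (flags U x x) \<le> card W \<and>
      (\<forall>xs\<in>W. g xs \<in> G j \<and> g xs \<in> prefixes xs \<and>
        (i < j \<longrightarrow> x \<subset> g xs) \<and> (j < i \<longrightarrow> g xs \<subset> x))))"
proof -
  define N where "N x = real (card (flags U x x))" for x
  define c where "c = e / (2 * real k * (real k - 1 + e))"
  define A where "A = permutations_of_set U"
  define T where "T = (\<Sum>xs\<in>A. real (length (trace F xs)))"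
  \<comment> \<open>A pair \<open>(xs, t)\<close> is the window of \<open>k\<close> consecutive
    trace members starting at index \<open>t\<close>.\<close>
  define C\<^sub>0 where "C\<^sub>0 = (SIGMA xs:A. {t. t + k \<le> length (trace F xs)})"
  have finA: "finite A" using U by (simp add: A_def)
  have finF: "finite F" using U by (metis finite_Pow_iff finite_subset)
  have dist: "distinct xs" if "xs \<in> A" for xs using that by (auto simp: A_def permutations_of_set_def)
  have ke: "real k - 1 + e > 0" using k e by simp
  have c: "c > 0" using ke k e by (simp add: c_def)
  have T: "T = (\<Sum>x\<in>F. N x)"
  proof -
    have "T = (\<Sum>xs\<in>A. \<Sum>x\<in>F. if x \<in> prefixes xs then 1 else 0)"
      unfolding T_def using dist finF by (intro sum.cong) (auto simp: length_trace sum.If_cases Int_def)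
    also have "\<dots> = (\<Sum>x\<in>F. \<Sum>xs\<in>A. if x \<in> prefixes xs then 1 else 0)" by (rule sum.swap)
    also have "\<dots> = (\<Sum>x\<in>F. N x)"
      using finA by (intro sum.cong) (auto simp: N_def flags_def A_def[symmetric] sum.If_cases Int_def)
    finally show ?thesis .
  qed
  \<comment> \<open>The LYM weight of each member, summed over \<open>F\<close>: an average chain
    meets at least \<open>k - 1 + e\<close> members.\<close>
  have Tge: "(real k - 1 + e) * fact (card U) \<le> T"
  proof -
    let ?b = "real (card U choose (card U div 2))"
    have b: "?b > 0" by simp
    have "(real k - 1 + e) * fact (card U) * ?b \<le> card F * fact (card U)"
      using mult_right_mono[OF large, of "fact (card U)"] by (simp add: mult_ac)
    also have "\<dots> = (\<Sum>x\<in>F. fact (card U))" by simp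
    also have "\<dots> \<le> (\<Sum>x\<in>F. N x * ?b)"
    proof (rule sum_mono)
      fix x assume "x \<in> F"
      hence "x \<subseteq> U" using U by blast
      hence "real (fact (card U)) \<le> real (card (flags U x x) * (card U choose (card U div 2)))"
        using card_flags_ge[OF U(1)] of_nat_mono by blast
      thus "fact (card U) \<le> N x * ?b" by (simp add: N_def)
    qed
    also have "\<dots> = T * ?b" by (simp add: T sum_distrib_right)
    finally show ?thesis using b by simp
  qed
  have Tpos: "T > 0" using Tge ke by (smt (verit) fact_gt_zero mult_pos_pos)
  have ndle: "{t. t + k \<le> m} = (if k \<le> m then {..m - k} else {})" for m by auto
  have fin0: "finite C\<^sub>0" unfolding C\<^sub>0_def using finA by (auto simp: ndle)
  have "T - (real k - 1) * fact (card U) = (\<Sum>xs\<in>A. real (length (trace F xs)) - (real k - 1))"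
    by (simp add: T_def sum_subtractf A_def U)
  \<comment> \<open>A trace of length \<open>m \<ge> k\<close> has \<open>m - (k - 1)\<close>
    windows; for a shorter trace this difference is at most zero.\<close>
  also have "\<dots> \<le> (\<Sum>xs\<in>A. real (card {t. t + k \<le> length (trace F xs)}))"
    by (intro sum_mono) (auto simp: ndle of_nat_diff)
  also have "\<dots> = card C\<^sub>0"
    unfolding C\<^sub>0_def using finA by (subst card_SigmaI) (auto simp: ndle)
  finally have card0: "T - (real k - 1) * fact (card U) \<le> card C\<^sub>0" .
  \<comment> \<open>This determines \<open>c\<close>: by \<open>Tge\<close> there are at least
    \<open>e / (k - 1 + e)\<close> times \<open>T\<close> windows, and the thresholds of all
    \<open>k\<close> levels together are half of that.\<close>
  have "k * (c * T) < T - (real k - 1) * fact (card U)"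
  proof -
    have "(real k - 1) * ((real k - 1 + e) * fact (card U)) \<le> (real k - 1) * T"
      using Tge k by (intro mult_left_mono) auto
    hence "(real k - 1) * fact (card U) \<le> (real k - 1) * T / (real k - 1 + e)"
      using ke by (simp add: field_simps)
    moreover have "k * (c * T) + (real k - 1) * T / (real k - 1 + e) < T"
    proof -
      define X where "X = real k - 1 + e"
      have X: "X > 0" using ke by (simp add: X_def)
      have "k * c = e / (2 * X)" using k by (simp add: c_def X_def)
      hence "k * (c * T) = e / (2 * X) * T" by (metis mult.assoc)
      hence "k * (c * T) + (real k - 1) * T / X = (e / 2 + (real k - 1)) / X * T"
        by (simp add: add_divide_distrib distrib_right)
      also have "\<dots> < 1 * T"
        using X Tpos e by (intro mult_strict_right_mono) (auto simp: X_def)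
      also have "\<dots> = T" by simp
      finally show ?thesis by (simp only: X_def)
    qed
    ultimately show ?thesis by linarith
  qed
  hence less: "(\<Sum>i\<in>{..<k}. \<Sum>x\<in>F. c * N x) < card C\<^sub>0"
    using card0 by (simp add: T sum_distrib_left)
  define key where "key i p = trace F (fst p) ! (snd p + i)" for i p
  have key: "key i p \<in> F" "key i p \<in> prefixes (fst p)" if "i < k" "p \<in> C\<^sub>0" for i p
  proof -
    have "snd p + i < length (trace F (fst p))" using that by (auto simp: C\<^sub>0_def)
    hence "key i p \<in> set (trace F (fst p))" unfolding key_def by (rule nth_mem)
    thus "key i p \<in> F" "key i p \<in> prefixes (fst p)" by (auto simp: set_trace)
  qed
  have "\<exists>C\<subseteq>C\<^sub>0. C \<noteq> {} \<and> (\<forall>i\<in>{..<k}. \<forall>a\<in>C. c * N (key i a) \<le> card {b \<in> C. key i b = key i a})"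
    by (rule prune_small_fibers[where F = F])
       (use fin0 finF key less c in \<open>auto simp: N_def\<close>)
  then obtain C where C: "C \<subseteq> C\<^sub>0" "C \<noteq> {}"
    and rich0: "\<forall>i\<in>{..<k}. \<forall>a\<in>C. c * N (key i a) \<le> card {b \<in> C. key i b = key i a}"
    by (elim exE conjE)
  hence rich: "c * N (key i a) \<le> card {b \<in> C. key i b = key i a}" if "i < k" "a \<in> C" for i a
    using that by simp
  \<comment> \<open>Level \<open>i\<close> consists of the sets still occupying place
    \<open>i\<close> of a surviving window.\<close>
  define G where "G i = key i ` C" for i
  have "\<exists>W g. W \<subseteq> flags U x x \<and> c * card (flags U x x) \<le> card W \<and>
      (\<forall>xs\<in>W. g xs \<in> G j \<and> g xs \<in> prefixes xs \<and> (i < j \<longrightarrow> x \<subset> g xs) \<and> (j < i \<longrightarrow> g xs \<subset> x))"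
    if ij: "i < k" "j < k" and x: "x \<in> G i" for i j x
  proof -
    define M where "M = {b \<in> C. key i b = x}"
    have MC: "M \<subseteq> C\<^sub>0" using C by (auto simp: M_def)
    have inj: "inj_on fst M"
    proof (rule inj_onI)
      fix p q assume p: "p \<in> M" and q: "q \<in> M" and eq: "fst p = fst q"
      have "snd p + i = snd q + i"
        by (rule trace_nth_inj[of "fst p" _ F])
           (use p q eq MC ij dist in \<open>auto simp: C\<^sub>0_def M_def key_def\<close>)
      thus "p = q" using eq by (simp add: prod_eq_iff)
    qed
    \<comment> \<open>By \<open>inj\<close> a chain has at most one surviving marking with
      \<open>x\<close> at level \<open>i\<close>; its level \<open>j\<close> is the set read
      off.\<close>
    define h where "h xs = key j (the_inv_into M fst xs)" for xs
    have h: "h (fst p) = key j p" if "p \<in> M" for p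
      using the_inv_into_f_f[OF inj that] by (simp add: h_def)
    have mem: "fst p \<in> flags U x x" "h (fst p) \<in> G j" "h (fst p) \<in> prefixes (fst p)"
       "i < j \<Longrightarrow> x \<subset> h (fst p)" "j < i \<Longrightarrow> h (fst p) \<subset> x" if p: "p \<in> M" for p
    proof -
      have p0: "p \<in> C\<^sub>0" "key i p = x" "p \<in> C" using p MC by (auto simp: M_def)
      have A: "fst p \<in> A" "snd p + k \<le> length (trace F (fst p))" using p0 by (auto simp: C\<^sub>0_def)
      show "fst p \<in> flags U x x" using key[OF ij(1) p0(1)] p0 A by (auto simp: flags_def A_def)
      show "h (fst p) \<in> G j" using p0 h[OF p] by (simp add: G_def)
      show "h (fst p) \<in> prefixes (fst p)" using key[OF ij(2) p0(1)] h[OF p] by simp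
      show "x \<subset> h (fst p)" if "i < j"
        unfolding h[OF p] p0(2)[symmetric] key_def
        using A dist ij that by (intro trace_nth_psubset) auto
      show "h (fst p) \<subset> x" if "j < i"
        unfolding h[OF p] p0(2)[symmetric] key_def
        using A dist ij that by (intro trace_nth_psubset) auto
    qed
    have "c * card (flags U x x) \<le> card (fst ` M)"
      using x rich[OF ij(1)] inj by (auto simp: G_def M_def N_def card_image)
    thus ?thesis using mem by (intro exI[of _ "fst ` M"] exI[of _ h]) auto
  qed
  moreover have "G i \<noteq> {} \<and> G i \<subseteq> F" if "i < k" for i
    using C key that by (auto simp: G_def)
  ultimately show ?thesis unfolding c_def by (intro exI[of _ G]) auto
qed

section \<open>Embedding tree posets\<close>

text \<open>The rank of \<open>x\<close> is one less than the largest size of a chain of elements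
  equal to or below \<open>x\<close>; placing \<open>y\<close> on top of such a chain lengthens it
  when \<open>lt x y\<close>. The shift by one makes ranks start at 0, like the levels.\<close>

lemma strict_poset_rank:
  assumes "strict_poset_on V lt"
  shows "\<exists>r. (\<forall>x\<in>V. r x < height V lt) \<and> (\<forall>x\<in>V. \<forall>y\<in>V. lt x y \<longrightarrow> r x < (r y :: nat))"
proof -
  have fin: "finite V" and irr: "\<And>x. x \<in> V \<Longrightarrow> \<not> lt x x"
    and tr: "\<And>x y z. x \<in> V \<Longrightarrow> y \<in> V \<Longrightarrow> z \<in> V \<Longrightarrow> lt x y \<Longrightarrow> lt y z \<Longrightarrow> lt x z"
    using assms unfolding strict_poset_on_def by blast+
  define D where "D x = {C. is_chain V lt C \<and> (\<forall>y\<in>C. y = x \<or> lt y x)}" for x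
  define \<rho> where "\<rho> x = Max (card ` D x)" for x
  have finD: "finite (D x)" for x
    by (rule finite_subset[of _ "Pow V"]) (use fin in \<open>auto simp: D_def is_chain_def\<close>)
  have sing: "{x} \<in> D x" if "x \<in> V" for x using that by (auto simp: D_def is_chain_def)
  have ge: "card C \<le> \<rho> x" if "C \<in> D x" for C x
    unfolding \<rho>_def using that finD by (intro Max_ge) auto
  have pos: "\<rho> x \<ge> 1" if "x \<in> V" for x using ge[OF sing[OF that]] by simp
  have att: "\<exists>C\<in>D x. card C = \<rho> x" if "x \<in> V" for x
  proof -
    have "\<rho> x \<in> card ` D x" unfolding \<rho>_def using finD sing[OF that] by (intro Max_in) auto
    thus ?thesis by auto
  qed
  have "finite {card C |C. is_chain V lt C}"
    by (rule finite_subset[of _ "card ` Pow V"]) (use fin in \<open>auto simp: is_chain_def\<close>)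
  hence le: "card C \<le> height V lt" if "is_chain V lt C" for C
    unfolding height_def using that by (intro Max_ge) auto
  have "\<rho> x - 1 < height V lt" if x: "x \<in> V" for x
  proof -
    obtain C where "C \<in> D x" "card C = \<rho> x" using att[OF x] by blast
    thus ?thesis using le[of C] pos[OF x] by (auto simp: D_def)
  qed
  moreover have "\<rho> x - 1 < \<rho> y - 1" if xy: "x \<in> V" "y \<in> V" "lt x y" for x y
  proof -
    obtain C where C: "C \<in> D x" "card C = \<rho> x" using att[OF xy(1)] by blast
    have CV: "C \<subseteq> V" using C by (auto simp: D_def is_chain_def)
    have below: "lt z y" if z: "z \<in> C" for z
    proof -
      have "z = x \<or> lt z x" using z C(1) by (simp add: D_def)
      thus ?thesis using z CV xy tr[of z x y] by blast
    qed
    have "y \<notin> C" using below irr xy by blast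
    moreover have "finite C" using CV fin finite_subset by blast
    moreover have "insert y C \<in> D y" using C below xy by (auto simp: D_def is_chain_def)
    ultimately have "Suc (\<rho> x) \<le> \<rho> y" using ge[of "insert y C" y] C by simp
    thus ?thesis using pos[OF xy(1)] by simp
  qed
  ultimately show ?thesis by (intro exI[of _ "\<lambda>x. \<rho> x - 1"]) auto
qed

section \<open>Cutting a Hasse tree at an edge\<close>

lemma rtranclp_imp_distinct_path:
  assumes "E\<^sup>*\<^sup>* a b" "b \<in> V" "\<And>x y. E x y \<Longrightarrow> x \<in> V"
  shows "\<exists>cs. cs \<noteq> [] \<and> hd cs = a \<and> last cs = b \<and> distinct cs \<and> set cs \<subseteq> V \<and> successively E cs"
  using assms(1)
proof (induction rule: converse_rtranclp_induct)
  case base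
  show ?case using assms(2) by (intro exI[of _ "[b]"]) auto
next
  case (step a c)
  then obtain cs where cs: "cs \<noteq> []" "hd cs = c" "last cs = b" "distinct cs" "set cs \<subseteq> V"
    "successively E cs" by blast
  show ?case
  proof (cases "a \<in> set cs")
    case True
    \<comment> \<open>A path already visiting \<open>a\<close> is replaced by its part from
      \<open>a\<close> onwards.\<close>
    then obtain xs ys where "cs = xs @ a # ys" by (auto simp: in_set_conv_decomp)
    thus ?thesis using cs by (intro exI[of _ "a # ys"]) (auto simp: successively_append_iff)
  next
    case False
    thus ?thesis using cs step(1) assms(3) by (intro exI[of _ "a # cs"]) (auto simp: successively_Cons)
  qed
qed

text \<open>The Hasse graph with the edge \<open>uv\<close> deleted.\<close>

definition adj_avoiding :: "'p set \<Rightarrow> ('p \<Rightarrow> 'p \<Rightarrow> bool) \<Rightarrow> 'p \<Rightarrow> 'p \<Rightarrow> 'p \<Rightarrow> 'p \<Rightarrow> bool" where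
  "adj_avoiding V lt u v a b \<longleftrightarrow> hasse_adj V lt a b \<and> {a, b} \<noteq> {u, v}"

text \<open>A path avoiding the edge would close up to a cycle with it.\<close>

lemma hasse_edge_separates:
  assumes "hasse_acyclic V lt" "hasse_adj V lt u v" "u \<noteq> v"
  shows "\<not> (adj_avoiding V lt u v)\<^sup>*\<^sup>* u v"
proof
  let ?E = "adj_avoiding V lt u v"
  assume "?E\<^sup>*\<^sup>* u v"
  moreover have "v \<in> V" using assms(2) by (auto simp: hasse_adj_def covers_def)
  moreover have "x \<in> V" if "?E x y" for x y
    using that by (auto simp: adj_avoiding_def hasse_adj_def covers_def)
  ultimately obtain cs where cs: "cs \<noteq> []" "hd cs = u" "last cs = v" "distinct cs" "set cs \<subseteq> V"
    "successively ?E cs" using rtranclp_imp_distinct_path[of ?E u v V] by blast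
  obtain d ds where d: "cs = u # d # ds" using cs assms(3)
    by (metis last.simps list.exhaust_sel)
  \<comment> \<open>A path with two vertices would be the deleted edge itself; hence the cycle has
    the three vertices required by \<open>hasse_acyclic\<close>.\<close>
  have "ds \<noteq> []"
    using cs d by (auto simp: adj_avoiding_def)
  hence "length cs \<ge> 3" using d by (cases ds) auto
  moreover have "\<forall>i < length cs - 1. hasse_adj V lt (cs ! i) (cs ! Suc i)"
    using cs(6) by (auto simp: successively_conv_nth adj_avoiding_def)
  moreover have "hasse_adj V lt (last cs) (hd cs)"
    using assms(2) cs by (auto simp: hasse_adj_def)
  ultimately show False using assms(1) cs unfolding hasse_acyclic_def by blast
qed

text \<open>Refine \<open>lt a b\<close> into covering steps, by induction on the number of elements
  strictly between. Either no step is the edge \<open>uv\<close>, or one is, and then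
  \<open>a\<close> is weakly below its lower end and \<open>b\<close> weakly above its upper
  end.\<close>

lemma comparable_path_cases:
  assumes P: "strict_poset_on V lt" and ab: "a \<in> V" "b \<in> V" "lt a b"
  shows "(adj_avoiding V lt u v)\<^sup>*\<^sup>* a b \<or>
    (covers V lt u v \<and> (a = u \<or> lt a u) \<and> (v = b \<or> lt v b)) \<or>
    (covers V lt v u \<and> (a = v \<or> lt a v) \<and> (u = b \<or> lt u b))"
  using ab
proof (induction "card {z \<in> V. lt a z \<and> lt z b}" arbitrary: a b rule: less_induct)
  case less
  have fin: "finite V" and irr: "\<And>x. x \<in> V \<Longrightarrow> \<not> lt x x"
    and tr: "\<And>x y z. x \<in> V \<Longrightarrow> y \<in> V \<Longrightarrow> z \<in> V \<Longrightarrow> lt x y \<Longrightarrow> lt y z \<Longrightarrow> lt x z"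
    using P unfolding strict_poset_on_def by blast+
  show ?case
  proof (cases "covers V lt a b")
    case True
    show ?thesis
    proof (cases "{a, b} = {u, v}")
      case True
      thus ?thesis using \<open>covers V lt a b\<close> by (auto simp: doubleton_eq_iff)
    next
      case False
      hence "adj_avoiding V lt u v a b" using True by (simp add: adj_avoiding_def hasse_adj_def)
      thus ?thesis by blast
    qed
  next
    case False
    then obtain z where z: "z \<in> V" "lt a z" "lt z b" using less.prems by (auto simp: covers_def)
    have "{w \<in> V. lt a w \<and> lt w z} \<subset> {w \<in> V. lt a w \<and> lt w b}"
      using z less.prems irr tr[of _ z b] by blast
    hence 1: "card {w \<in> V. lt a w \<and> lt w z} < card {w \<in> V. lt a w \<and> lt w b}"
      using fin by (intro psubset_card_mono) auto
    have "{w \<in> V. lt z w \<and> lt w b} \<subset> {w \<in> V. lt a w \<and> lt w b}"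
      using z less.prems irr tr[of a z] by blast
    hence 2: "card {w \<in> V. lt z w \<and> lt w b} < card {w \<in> V. lt a w \<and> lt w b}"
      using fin by (intro psubset_card_mono) auto
    have uvV: "u \<in> V" "v \<in> V" if "covers V lt u v \<or> covers V lt v u"
      using that by (auto simp: covers_def)
    note IH1 = less.hyps[OF 1 less.prems(1) z(1,2)] and IH2 = less.hyps[OF 2 z(1) less.prems(2) z(3)]
    consider (avoid) "(adj_avoiding V lt u v)\<^sup>*\<^sup>* a z" "(adj_avoiding V lt u v)\<^sup>*\<^sup>* z b"
      | (uv1) "covers V lt u v" "a = u \<or> lt a u" "v = z \<or> lt v z"
      | (vu1) "covers V lt v u" "a = v \<or> lt a v" "u = z \<or> lt u z"
      | (uv2) "covers V lt u v" "z = u \<or> lt z u" "v = b \<or> lt v b"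
      | (vu2) "covers V lt v u" "z = v \<or> lt z v" "u = b \<or> lt u b"
      using IH1 IH2 by blast
    thus ?thesis
    proof cases
      case avoid
      thus ?thesis by (meson rtranclp_trans)
    next
      case uv1
      hence "lt v b" using z less.prems tr[of v z b] uvV by blast
      thus ?thesis using uv1 by blast
    next
      case vu1
      hence "lt u b" using z less.prems tr[of u z b] uvV by blast
      thus ?thesis using vu1 by blast
    next
      case uv2
      hence "lt a u" using z less.prems tr[of a z u] uvV by blast
      thus ?thesis using uv2 by blast
    next
      case vu2
      hence "lt a v" using z less.prems tr[of a z v] uvV by blast
      thus ?thesis using vu2 by blast
    qed
  qed
qed

text \<open>Removing the edge \<open>uv\<close> of the Hasse tree disconnects \<open>v\<close> from \<open>S\<close>, so every saturated
  chain between \<open>v\<close> and a member of \<open>S\<close> runs through \<open>u\<close>.\<close>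

lemma tree_poset_leaf_order:
  assumes T: "tree_poset V lt" and S: "S \<subseteq> V" "u \<in> S" "v \<in> V" "v \<notin> S" "hasse_adj V lt u v"
    and conn: "\<forall>w\<in>S. (\<lambda>a b. hasse_adj V lt a b \<and> a \<in> S \<and> b \<in> S)\<^sup>*\<^sup>* u w"
    and w: "w \<in> S"
  shows "lt u v \<Longrightarrow> (lt w v \<longleftrightarrow> w = u \<or> lt w u)" "lt u v \<Longrightarrow> \<not> lt v w"
    "lt v u \<Longrightarrow> (lt v w \<longleftrightarrow> w = u \<or> lt u w)" "lt v u \<Longrightarrow> \<not> lt w v"
proof -
  have P: "strict_poset_on V lt" and ac: "hasse_acyclic V lt" using T by (auto simp: tree_poset_def)
  have irr: "\<And>x. x \<in> V \<Longrightarrow> \<not> lt x x"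
    and tr: "\<And>x y z. x \<in> V \<Longrightarrow> y \<in> V \<Longrightarrow> z \<in> V \<Longrightarrow> lt x y \<Longrightarrow> lt y z \<Longrightarrow> lt x z"
    using P unfolding strict_poset_on_def by blast+
  let ?E = "adj_avoiding V lt u v"
  have sep: "\<not> ?E\<^sup>*\<^sup>* u v" using hasse_edge_separates[OF ac S(5)] S by blast
  \<comment> \<open>Paths inside \<open>S\<close> cannot use the edge, because
    \<open>v \<notin> S\<close>; together with \<open>sep\<close> this cuts every member of
    \<open>S\<close> off from \<open>v\<close>.\<close>
  have "?E\<^sup>*\<^sup>* u w"
    using bspec[OF conn w] by (rule rtranclp_mono[THEN predicate2D, rotated])
      (use S in \<open>auto simp: adj_avoiding_def\<close>)
  moreover have sym: "symp ?E" by (auto simp: symp_def adj_avoiding_def hasse_adj_def insert_commute)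
  ultimately have n: "\<not> ?E\<^sup>*\<^sup>* w v" "\<not> ?E\<^sup>*\<^sup>* v w"
    using sep by (meson rtranclp_trans symp_rtranclp sympD)+
  have V: "u \<in> V" "w \<in> V" using S w by auto
  have cv: "lt a b" if "covers V lt a b" for a b using that by (simp add: covers_def)
  show "lt w v \<longleftrightarrow> w = u \<or> lt w u" if uv: "lt u v"
  proof
    assume "lt w v"
    from comparable_path_cases[OF P V(2) S(3) this, of u v]
    show "w = u \<or> lt w u" using n cv uv irr tr V S(3) by blast
  next
    assume "w = u \<or> lt w u"
    thus "lt w v" using uv tr V S(3) by blast
  qed
  show "\<not> lt v w" if uv: "lt u v"
  proof
    assume "lt v w"
    from comparable_path_cases[OF P S(3) V(2) this, of u v]
    show False using n cv uv irr tr V S(3) by blast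
  qed
  show "lt v w \<longleftrightarrow> w = u \<or> lt u w" if uv: "lt v u"
  proof
    assume "lt v w"
    from comparable_path_cases[OF P S(3) V(2) this, of u v]
    show "w = u \<or> lt u w" using n cv uv irr tr V S(3) by blast
  next
    assume "w = u \<or> lt u w"
    thus "lt v w" using uv tr V S(3) by blast
  qed
  show "\<not> lt w v" if uv: "lt v u"
  proof
    assume "lt w v"
    from comparable_path_cases[OF P V(2) S(3) this, of u v]
    show False using n cv uv irr tr V S(3) by blast
  qed
qed

section \<open>Growing an embedded subtree vertex by vertex\<close>

lemma connected_extension:
  assumes "hasse_connected V lt" "S \<subseteq> V" "S \<noteq> {}" "S \<noteq> V"
  shows "\<exists>u\<in>S. \<exists>v\<in>V - S. hasse_adj V lt u v"
proof (rule ccontr)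
  assume neg: "\<not> ?thesis"
  obtain s t where st: "s \<in> S" "t \<in> V - S" using assms by blast
  have "(hasse_adj V lt)\<^sup>*\<^sup>* s t" using assms(1,2) st by (auto simp: hasse_connected_def)
  hence "t \<in> S"
  proof induction
    case base
    show ?case using st by blast
  next
    case (step y z)
    have "z \<in> V" using step(2) by (auto simp: hasse_adj_def covers_def)
    thus ?case using step neg by blast
  qed
  thus False using st by blast
qed

text \<open>The deterministic part: \<open>Q\<close> is any property to be preserved, later the
  absence of saturated subsets. A new set \<open>y\<close> is only required to be comparable with
  the image \<open>x\<close> of its neighbour and to gain no relations beyond those implied by
  \<open>x\<close>; by \<open>tree_poset_leaf_order\<close> this is exactly the order of the
  tree.\<close>

lemma tree_embedding:
  fixes G :: "nat \<Rightarrow> 'a set set" and r :: "'p \<Rightarrow> nat"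
  assumes T: "tree_poset V lt"
    and r: "\<And>x. x \<in> V \<Longrightarrow> r x < k" "\<And>x y. x \<in> V \<Longrightarrow> y \<in> V \<Longrightarrow> lt x y \<Longrightarrow> r x < r y"
    and G: "\<And>i. i < k \<Longrightarrow> G i \<noteq> {} \<and> G i \<subseteq> F"
    and init: "\<And>x. x \<in> F \<Longrightarrow> Q {x}"
    and up: "\<And>i j x A. i < j \<Longrightarrow> j < k \<Longrightarrow> x \<in> G i \<Longrightarrow> x \<in> A \<Longrightarrow> A \<subseteq> F \<Longrightarrow> card A < card V \<Longrightarrow> Q A \<Longrightarrow>
      \<exists>y\<in>G j. Q (insert y A) \<and> x \<subset> y \<and> (\<forall>z\<in>A. \<not> y \<subseteq> z \<and> (z \<subseteq> y \<longrightarrow> z \<subseteq> x))"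
    and down: "\<And>i j x A. j < i \<Longrightarrow> i < k \<Longrightarrow> x \<in> G i \<Longrightarrow> x \<in> A \<Longrightarrow> A \<subseteq> F \<Longrightarrow> card A < card V \<Longrightarrow> Q A \<Longrightarrow>
      \<exists>y\<in>G j. Q (insert y A) \<and> y \<subset> x \<and> (\<forall>z\<in>A. \<not> z \<subseteq> y \<and> (y \<subseteq> z \<longrightarrow> x \<subseteq> z))"
  shows "\<exists>f. inj_on f V \<and> f ` V \<subseteq> F \<and> Q (f ` V) \<and> (\<forall>x\<in>V. \<forall>y\<in>V. f x \<subset> f y \<longleftrightarrow> lt x y)"
proof -
  have P: "strict_poset_on V lt" and con: "hasse_connected V lt" using T by (auto simp: tree_poset_def)
  have fin: "finite V" and irr: "\<And>x. x \<in> V \<Longrightarrow> \<not> lt x x" using P unfolding strict_poset_on_def by blast+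
  have ne: "V \<noteq> {}" using con by (simp add: hasse_connected_def)
  \<comment> \<open>Connectedness of the embedded part is carried along because
    \<open>tree_poset_leaf_order\<close> needs it at the next vertex.\<close>
  define emb where "emb S f \<longleftrightarrow> S \<subseteq> V \<and> inj_on f S \<and> (\<forall>x\<in>S. f x \<in> G (r x)) \<and> Q (f ` S) \<and>
    (\<forall>x\<in>S. \<forall>y\<in>S. f x \<subset> f y \<longleftrightarrow> lt x y) \<and>
    (\<forall>a\<in>S. \<forall>b\<in>S. (\<lambda>a b. hasse_adj V lt a b \<and> a \<in> S \<and> b \<in> S)\<^sup>*\<^sup>* a b)" for S f
  have "\<exists>S f. card S = Suc t \<and> emb S f" if "Suc t \<le> card V" for t
    using that
  proof (induction t)
    case 0
    obtain v where v: "v \<in> V" using ne by blast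
    obtain x where "x \<in> G (r v)" using G[OF r(1)[OF v]] by blast
    hence "emb {v} (\<lambda>_. x)" using v irr init G[OF r(1)[OF v]] by (auto simp: emb_def)
    thus ?case by (intro exI[of _ "{v}"] exI[of _ "\<lambda>_. x"]) simp
  next
    case (Suc t)
    then obtain S f where card: "card S = Suc t" and e: "emb S f" by auto
    have SV: "S \<subseteq> V" and inj: "inj_on f S" and fG: "\<And>x. x \<in> S \<Longrightarrow> f x \<in> G (r x)" and QS: "Q (f ` S)"
      and ord: "\<And>x y. x \<in> S \<Longrightarrow> y \<in> S \<Longrightarrow> f x \<subset> f y \<longleftrightarrow> lt x y"
      and conn: "\<And>a b. a \<in> S \<Longrightarrow> b \<in> S \<Longrightarrow> (\<lambda>a b. hasse_adj V lt a b \<and> a \<in> S \<and> b \<in> S)\<^sup>*\<^sup>* a b"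
      using e unfolding emb_def by blast+
    have finS: "finite S" using SV fin finite_subset by blast
    have "S \<noteq> {}" "S \<noteq> V" using card Suc.prems by auto
    then obtain u v where u: "u \<in> S" and v: "v \<in> V" "v \<notin> S" and uv: "hasse_adj V lt u v"
      using connected_extension[OF con SV] by blast
    have uV: "u \<in> V" using u SV by blast
    have "\<forall>w\<in>S. (\<lambda>a b. hasse_adj V lt a b \<and> a \<in> S \<and> b \<in> S)\<^sup>*\<^sup>* u w" using conn[OF u] by blast
    note leaf = tree_poset_leaf_order[OF T SV u v uv this]
    have fF: "f ` S \<subseteq> F" using fG G r(1) SV by fastforce
    have cA: "card (f ` S) < card V" using inj card Suc.prems by (simp add: card_image)
    have "\<exists>y\<in>G (r v). Q (insert y (f ` S)) \<and>
      (\<forall>w\<in>S. f w \<noteq> y \<and> (f w \<subset> y \<longleftrightarrow> lt w v) \<and> (y \<subset> f w \<longleftrightarrow> lt v w))"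
    proof (cases "lt u v")
      case True
      from up[OF r(2)[OF uV v(1) True] r(1)[OF v(1)] fG[OF u] imageI[OF u] fF cA QS]
      obtain y where y: "y \<in> G (r v)" "Q (insert y (f ` S))" "f u \<subset> y"
        "\<forall>z\<in>f ` S. \<not> y \<subseteq> z \<and> (z \<subseteq> y \<longrightarrow> z \<subseteq> f u)"
        by (elim bexE conjE)
      have "f w \<noteq> y \<and> (f w \<subset> y \<longleftrightarrow> lt w v) \<and> (y \<subset> f w \<longleftrightarrow> lt v w)" if w: "w \<in> S" for w
      proof -
        have iw: "\<not> y \<subseteq> f w" "f w \<subseteq> y \<longrightarrow> f w \<subseteq> f u" using bspec[OF y(4) imageI[OF w]] by auto
        \<comment> \<open>Injectivity turns inclusion of images into equality or \<open>lt\<close>,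
          the form in which the leaf lemma speaks.\<close>
        have "f w \<subseteq> f u \<longleftrightarrow> w = u \<or> lt w u"
          using ord[OF w u] inj w u by (auto simp: inj_on_def psubset_eq)
        hence "f w \<subseteq> y \<longleftrightarrow> lt w v" using iw y(3) leaf(1)[OF w True] by blast
        thus ?thesis using iw leaf(2)[OF w True] by blast
      qed
      thus ?thesis using y by blast
    next
      case False
      hence vu: "lt v u" using uv by (auto simp: hasse_adj_def covers_def)
      from down[OF r(2)[OF v(1) uV vu] r(1)[OF uV] fG[OF u] imageI[OF u] fF cA QS]
      obtain y where y: "y \<in> G (r v)" "Q (insert y (f ` S))" "y \<subset> f u"
        "\<forall>z\<in>f ` S. \<not> z \<subseteq> y \<and> (y \<subseteq> z \<longrightarrow> f u \<subseteq> z)"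
        by (elim bexE conjE)
      have "f w \<noteq> y \<and> (f w \<subset> y \<longleftrightarrow> lt w v) \<and> (y \<subset> f w \<longleftrightarrow> lt v w)" if w: "w \<in> S" for w
      proof -
        have iw: "\<not> f w \<subseteq> y" "y \<subseteq> f w \<longrightarrow> f u \<subseteq> f w" using bspec[OF y(4) imageI[OF w]] by auto
        have "f u \<subseteq> f w \<longleftrightarrow> w = u \<or> lt u w"
          using ord[OF u w] inj w u by (auto simp: inj_on_def psubset_eq)
        hence "y \<subseteq> f w \<longleftrightarrow> lt v w" using iw y(3) leaf(3)[OF w vu] by blast
        thus ?thesis using iw leaf(4)[OF w vu] by blast
      qed
      thus ?thesis using y by blast
    qed
    then obtain y where y: "y \<in> G (r v)" "Q (insert y (f ` S))"
      and yw: "\<And>w. w \<in> S \<Longrightarrow> f w \<noteq> y \<and> (f w \<subset> y \<longleftrightarrow> lt w v) \<and> (y \<subset> f w \<longleftrightarrow> lt v w)" by blast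
    let ?f = "f(v := y)" and ?S = "insert v S"
    let ?R = "\<lambda>a b. hasse_adj V lt a b \<and> a \<in> ?S \<and> b \<in> ?S"
    have fv: "?f v = y" and fw: "\<And>w. w \<in> S \<Longrightarrow> ?f w = f w" using v by auto
    have fS: "?f ` S = f ` S" using fw by (intro image_cong refl) blast
    have img: "?f ` ?S = insert y (f ` S)" unfolding image_insert fS fv ..
    have "inj_on ?f S" using inj fw by (subst inj_on_cong[of S ?f f]) blast+
    moreover have "y \<notin> f ` S" using yw by blast
    ultimately have inj': "inj_on ?f ?S"
      using v(2) by (simp only: inj_on_insert Diff_insert0 Diff_empty fS fv simp_thms)
    have ord': "?f a \<subset> ?f b \<longleftrightarrow> lt a b" if "a \<in> ?S" "b \<in> ?S" for a b
    proof (cases "a = v"; cases "b = v")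
      assume "a \<noteq> v" "b \<noteq> v"
      hence "a \<in> S" "b \<in> S" using that by auto
      thus ?thesis using ord fw by simp
    next
      assume "a = v" "b \<noteq> v"
      thus ?thesis using that yw[of b] by simp
    next
      assume "a \<noteq> v" "b = v"
      thus ?thesis using that yw[of a] by simp
    qed (use irr[OF v(1)] in simp)
    have RS: "?R\<^sup>*\<^sup>* a b" if "a \<in> S" "b \<in> S" for a b
      using conn[OF that] by (rule rtranclp_mono[THEN predicate2D, rotated]) auto
    have Ruv: "?R u v" "?R v u" using uv u by (auto simp: hasse_adj_def)
    have conn': "?R\<^sup>*\<^sup>* a b" if "a \<in> ?S" "b \<in> ?S" for a b
    proof -
      have "?R\<^sup>*\<^sup>* a u" if "a \<in> ?S" for a
        using that RS[of a u] u Ruv(2) by blast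
      moreover have "?R\<^sup>*\<^sup>* u b" if "b \<in> ?S" for b
        using that RS[of u b] u Ruv(1) by blast
      ultimately show ?thesis using that by (meson rtranclp_trans)
    qed
    have "emb ?S ?f"
      unfolding emb_def
    proof (intro conjI ballI)
      show "?S \<subseteq> V" using SV v by blast
      show "inj_on ?f ?S" by (rule inj')
      show "?f x \<in> G (r x)" if "x \<in> ?S" for x using that fG y by auto
      show "Q (?f ` ?S)" unfolding img by (rule y(2))
      show "?f a \<subset> ?f b \<longleftrightarrow> lt a b" if "a \<in> ?S" "b \<in> ?S" for a b by (rule ord'[OF that])
      show "?R\<^sup>*\<^sup>* a b" if "a \<in> ?S" "b \<in> ?S" for a b by (rule conn'[OF that])
    qed
    moreover have "card ?S = Suc (Suc t)" using card v finS by simp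
    ultimately show ?case by blast
  qed
  moreover have "card V > 0" using fin ne by (simp add: card_gt_0_iff)
  ultimately obtain S f where Sf: "card S = card V" "emb S f"
    by (metis Suc_pred le_refl)
  have "S = V" using Sf fin by (intro card_subset_eq) (auto simp: emb_def)
  hence e: "emb V f" using Sf by simp
  moreover have "f ` V \<subseteq> F" using e G r(1) by (fastforce simp: emb_def)
  ultimately show ?thesis unfolding emb_def by blast
qed

section \<open>Saturated sets and balanced collections\<close>

lemma eventually_sqrt_ln_small:
  assumes "\<eta> > 0"
  shows "eventually (\<lambda>n. sqrt (real n * ln (real n)) \<le> \<eta> * real n) sequentially"
proof -
  have "((\<lambda>n. ln (real n) / real n) \<longlongrightarrow> 0) sequentially"
    by (rule filterlim_compose[OF ln_x_over_x_tendsto_0 filterlim_real_sequentially])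
  hence "eventually (\<lambda>n. ln (real n) / real n < \<eta>\<^sup>2) sequentially"
    using assms by (intro order_tendstoD) auto
  thus ?thesis using eventually_gt_at_top[of 0]
  proof eventually_elim
    case (elim n)
    hence "real n * ln (real n) \<le> (\<eta> * real n)\<^sup>2"
      by (simp add: power2_eq_square field_simps)
    hence "sqrt (real n * ln (real n)) \<le> sqrt ((\<eta> * real n)\<^sup>2)" by (rule real_sqrt_le_mono)
    thus ?case using assms by simp
  qed
qed

lemma hdeg_insert_le: "finite H \<Longrightarrow> hdeg (insert h H) D \<le> hdeg H D + (if D \<subseteq> h then 1 else 0)"
proof -
  assume "finite H"
  have "{g \<in> insert h H. D \<subseteq> g} \<subseteq> {g \<in> H. D \<subseteq> g} \<union> (if D \<subseteq> h then {h} else {})" by auto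
  hence "card {g \<in> insert h H. D \<subseteq> g} \<le> card ({g \<in> H. D \<subseteq> g} \<union> (if D \<subseteq> h then {h} else {}))"
    using \<open>finite H\<close> by (intro card_mono) auto
  also have "\<dots> \<le> card {g \<in> H. D \<subseteq> g} + card (if D \<subseteq> h then {h} else {})" by (rule card_Un_le)
  finally show ?thesis by (auto simp: hdeg_def split: if_splits)
qed

text \<open>Double counting of pairs of a \<open>y\<close> in \<open>Y\<close> and an edge
  containing \<open>A\<close> and \<open>y\<close>: each \<open>y\<close> occurs in at least
  \<open>\<Delta> ^ p / 2\<close> pairs, each edge in at most \<open>m\<close>.\<close>

lemma card_saturated_extensions:
  fixes \<Delta> X :: real
  assumes H: "finite H" "\<And>h. h \<in> H \<Longrightarrow> finite h \<and> card h = m"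
    and Y: "finite Y" "\<And>y. y \<in> Y \<Longrightarrow> \<Delta> ^ p < real (hdeg H (insert y A)) + 1"
    and \<Delta>: "\<Delta> \<ge> 2" and X: "real (hdeg H A) \<le> X * \<Delta> ^ p"
  shows "real (card Y) \<le> 2 * real m * X"
proof -
  \<comment> \<open>For \<open>p = 0\<close> saturation means positive degree, hence degree at least
    one; for \<open>p > 0\<close>, \<open>\<Delta> \<ge> 2\<close> makes
    \<open>\<Delta> ^ p - 1\<close> at least half of \<open>\<Delta> ^ p\<close>.\<close>
  have half: "\<Delta> ^ p / 2 \<le> real (hdeg H (insert y A))" if y: "y \<in> Y" for y
  proof (cases p)
    case 0
    thus ?thesis using Y(2)[OF y] by simp
  next
    case (Suc q)
    have "\<Delta> ^ p \<ge> 2 * 1" unfolding Suc power_Suc using \<Delta> by (intro mult_mono) auto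
    thus ?thesis using Y(2)[OF y] by linarith
  qed
  have "card Y * (\<Delta> ^ p / 2) \<le> (\<Sum>y\<in>Y. real (hdeg H (insert y A)))"
    using sum_mono[OF half, of Y] by simp
  also have "\<dots> = (\<Sum>y\<in>Y. \<Sum>h | h \<in> H \<and> A \<subseteq> h. if y \<in> h then 1 else 0)"
    using H by (intro sum.cong refl) (auto simp: hdeg_def sum.If_cases intro!: arg_cong[of _ _ card])
  also have "\<dots> = (\<Sum>h | h \<in> H \<and> A \<subseteq> h. \<Sum>y\<in>Y. if y \<in> h then 1 else 0)" by (rule sum.swap)
  also have "\<dots> \<le> (\<Sum>h | h \<in> H \<and> A \<subseteq> h. real m)"
  proof (rule sum_mono)
    fix h assume "h \<in> {h. h \<in> H \<and> A \<subseteq> h}"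
    hence "card (Y \<inter> h) \<le> m" using H(2)[of h] by (metis (no_types, lifting) Int_lower2 card_mono mem_Collect_eq)
    thus "(\<Sum>y\<in>Y. if y \<in> h then 1 else 0) \<le> real m" using Y(1) by (simp add: sum.If_cases)
  qed
  also have "\<dots> = m * real (hdeg H A)" by (simp add: hdeg_def)
  also have "\<dots> \<le> m * (X * \<Delta> ^ p)" using X by (intro mult_left_mono) auto
  finally have "card Y * (\<Delta> ^ p / 2) \<le> (2 * real m * X) * (\<Delta> ^ p / 2)" by (simp add: algebra_simps)
  thus ?thesis using \<Delta> by (subst (asm) mult_le_cancel_right_pos) auto
qed

text \<open>The right side of \<open>bound\<close> is the density supplied by
  \<open>rich_levels\<close>, the left side the failure probability of one random step. Sizes in the
  middle third make \<open>card x\<close> and \<open>n - card x\<close> at least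
  \<open>n / 3\<close>, hence the factors 3; \<open>\<beta>\<close> bounds the number of forbidden
  next vertices.\<close>

lemma induced_copy_avoiding:
  fixes e \<beta> :: real
  assumes T: "tree_poset V lt" and e: "e > 0" and l: "l \<ge> 1" and n: "n > 0"
    and F: "F \<subseteq> Pow {1..n}" "gapped l F"
    and mid: "\<And>x. x \<in> F \<Longrightarrow> n \<le> 3 * card x \<and> 3 * card x \<le> 2 * n" "3 * l \<le> n"
    and s: "\<And>x y. x \<in> F \<Longrightarrow> y \<in> F \<Longrightarrow> card y \<le> card x + s"
    and large: "(real (height V lt) - 1 + e) * (n choose (n div 2)) \<le> card F"
    and init: "\<And>x. x \<in> F \<Longrightarrow> Q {x}"
    and ext: "\<And>A. A \<subseteq> F \<Longrightarrow> Q A \<Longrightarrow> A \<noteq> {} \<Longrightarrow> card A < card V \<Longrightarrow>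
      real (card {y \<in> F. \<not> Q (insert y A)}) \<le> \<beta>"
    and bound: "\<beta> * (3 * real l / real n) ^ l + 2 * real (card V) * (3 * real s / real n)
      < e / (2 * real (height V lt) * (real (height V lt) - 1 + e))"
  shows "\<exists>f. inj_on f V \<and> f ` V \<subseteq> F \<and> Q (f ` V) \<and> (\<forall>x\<in>V. \<forall>y\<in>V. f x \<subset> f y \<longleftrightarrow> lt x y)"
proof -
  define k where "k = height V lt"
  define c where "c = e / (2 * real k * (real k - 1 + e))"
  let ?U = "{1..n}"
  have P: "strict_poset_on V lt" and ne: "V \<noteq> {}"
    using T by (auto simp: tree_poset_def hasse_connected_def)
  obtain r where r: "\<And>x. x \<in> V \<Longrightarrow> r x < k" "\<And>x y. x \<in> V \<Longrightarrow> y \<in> V \<Longrightarrow> lt x y \<Longrightarrow> r x < (r y :: nat)"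
    using strict_poset_rank[OF P] unfolding k_def by blast
  have k: "k \<ge> 1" using ne r(1) by (metis all_not_in_conv less_one not_le not_less_zero)
  have "\<exists>G. (\<forall>i<k. G i \<noteq> {} \<and> G i \<subseteq> F) \<and>
    (\<forall>i<k. \<forall>j<k. i \<noteq> j \<longrightarrow> (\<forall>x\<in>G i. \<exists>W g. W \<subseteq> flags ?U x x \<and>
      c * card (flags ?U x x) \<le> card W \<and>
      (\<forall>xs\<in>W. g xs \<in> G j \<and> g xs \<in> prefixes xs \<and>
        (i < j \<longrightarrow> x \<subset> g xs) \<and> (j < i \<longrightarrow> g xs \<subset> x))))"
    unfolding c_def
    by (rule rich_levels) (use F k e large in \<open>auto simp: k_def\<close>)
  then obtain G where G0: "\<forall>i<k. G i \<noteq> {} \<and> G i \<subseteq> F"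
    and step0: "\<forall>i<k. \<forall>j<k. i \<noteq> j \<longrightarrow> (\<forall>x\<in>G i. \<exists>W g. W \<subseteq> flags ?U x x \<and>
      c * card (flags ?U x x) \<le> card W \<and>
      (\<forall>xs\<in>W. g xs \<in> G j \<and> g xs \<in> prefixes xs \<and>
        (i < j \<longrightarrow> x \<subset> g xs) \<and> (j < i \<longrightarrow> g xs \<subset> x)))"
    by (elim exE conjE)
  have G: "G i \<noteq> {} \<and> G i \<subseteq> F" if "i < k" for i using G0 that by blast
  note step = step0[rule_format]
  have finF: "finite F" using F(1) by (rule finite_subset) simp
  have midr: "real n \<le> 3 * real (card x)" "3 * real (card x) \<le> 2 * real n" if "x \<in> F" for x
  proof -
    have "real n \<le> real (3 * card x)" "real (3 * card x) \<le> real (2 * n)"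
      using mid(1)[OF that] by (simp_all only: of_nat_le_iff)
    thus "real n \<le> 3 * real (card x)" "3 * real (card x) \<le> 2 * real n" by simp_all
  qed
  have gap: "l \<le> card (y - x)" if "x \<in> F" "y \<in> F" "x \<subset> y" for x y
    using F(2) that by (auto simp: gapped_def)
  \<comment> \<open>\<open>q\<close> stands for \<open>n - card x\<close> in upward steps and for
    \<open>card x\<close> in downward ones.\<close>
  have small: "card {y \<in> F. \<not> Q (insert y A)} * (l / q) ^ l + 2 * real (card A) * (s / q) < c"
    if A: "A \<subseteq> F" "Q A" "A \<noteq> {}" "card A < card V" and q: "n \<le> 3 * q" for A and q :: real
  proof -
    have q0: "q > 0" using q n by linarith
    have lq: "real t / q \<le> 3 * real t / real n" for t :: nat
    proof -
      have "real t * n \<le> real t * (3 * q)" using q by (intro mult_left_mono) auto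
      thus ?thesis using q0 n by (simp add: field_simps)
    qed
    have "card {y \<in> F. \<not> Q (insert y A)} * (l / q) ^ l \<le> \<beta> * (3 * real l / real n) ^ l"
      using ext[OF A] lq[of l] q0 order_trans[OF of_nat_0_le_iff ext[OF A]]
      by (intro mult_mono power_mono) auto
    moreover have "2 * real (card A) * (s / q) \<le> 2 * real (card V) * (3 * real s / real n)"
      using A lq[of s] q0 by (intro mult_mono) auto
    ultimately show ?thesis using bound unfolding c_def k_def by linarith
  qed
  show ?thesis
  proof (rule tree_embedding[where V = V and lt = lt and r = r and G = G and F = F and Q = Q and k = k,
      OF T r G init])
    fix i j x A
    assume ij: "i < j" "j < k" and x: "x \<in> G i" "x \<in> A" and A: "A \<subseteq> F" "card A < card V" "Q A"
    from step[OF order.strict_trans[OF ij] ij(2) less_imp_neq[OF ij(1)] x(1)]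
    obtain W g where W: "W \<subseteq> flags ?U x x" "c * card (flags ?U x x) \<le> card W"
      and g: "\<forall>xs\<in>W. g xs \<in> G j \<and> g xs \<in> prefixes xs \<and>
        (i < j \<longrightarrow> x \<subset> g xs) \<and> (j < i \<longrightarrow> g xs \<subset> x)"
      by (elim exE conjE)
    have xF: "x \<in> F" using x A by blast
    have gF: "g xs \<in> F" "g xs \<in> G j" "g xs \<in> prefixes xs" "x \<subset> g xs" if "xs \<in> W" for xs
      using g that ij G[OF ij(2)] by auto
    have "\<exists>xs\<in>W. g xs \<notin> {y \<in> F. \<not> Q (insert y A)} \<and>
      (\<forall>z\<in>A. \<not> g xs \<subseteq> z \<and> (z \<subseteq> g xs \<longrightarrow> z \<subseteq> x))"
    proof (rule chain_step_up[where U = ?U and l = l and s = s and c = c])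
      show "x \<subseteq> ?U" using xF F by blast
      show "g xs \<in> prefixes xs \<and> x \<subset> g xs \<and> l \<le> card (g xs - x) \<and>
        card (g xs) \<le> card x + s \<and> card (g xs) + l \<le> card ?U" if "xs \<in> W" for xs
        using gF[OF that] gap[OF xF] s[OF xF] mid(1)[of "g xs"] mid(2) by auto
      show "z \<subseteq> ?U \<and> card z \<le> card x + s" if "z \<in> A" for z using that A F s[OF xF] by blast
      have "real n \<le> 3 * (real n - card x)"
        using midr(2)[OF xF] by (simp add: right_diff_distrib)
      thus "card {y \<in> F. \<not> Q (insert y A)} * (l / (real (card ?U) - card x)) ^ l +
        2 * real (card A) * (s / (real (card ?U) - card x)) < c"
        using small[of A "real n - card x"] A x by auto
    qed (use W A finF finite_subset l in auto)
    then obtain xs where xs: "xs \<in> W" "g xs \<notin> {y \<in> F. \<not> Q (insert y A)}"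
      "\<forall>z\<in>A. \<not> g xs \<subseteq> z \<and> (z \<subseteq> g xs \<longrightarrow> z \<subseteq> x)"
      by (elim bexE conjE)
    moreover have "Q (insert (g xs) A)" using xs(2) gF(1)[OF xs(1)] by simp
    ultimately show "\<exists>y\<in>G j. Q (insert y A) \<and> x \<subset> y \<and> (\<forall>z\<in>A. \<not> y \<subseteq> z \<and> (z \<subseteq> y \<longrightarrow> z \<subseteq> x))"
      using gF(2,4)[OF xs(1)] by (intro bexI[of _ "g xs"] conjI)
  next
    fix i j x A
    assume ij: "j < i" "i < k" and x: "x \<in> G i" "x \<in> A" and A: "A \<subseteq> F" "card A < card V" "Q A"
    have jk: "j < k" using ij by simp
    from step[OF ij(2) jk less_imp_neq[OF ij(1), symmetric] x(1)]
    obtain W g where W: "W \<subseteq> flags ?U x x" "c * card (flags ?U x x) \<le> card W"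
      and g: "\<forall>xs\<in>W. g xs \<in> G j \<and> g xs \<in> prefixes xs \<and>
        (i < j \<longrightarrow> x \<subset> g xs) \<and> (j < i \<longrightarrow> g xs \<subset> x)"
      by (elim exE conjE)
    have xF: "x \<in> F" using x A by blast
    have gF: "g xs \<in> F" "g xs \<in> G j" "g xs \<in> prefixes xs" "g xs \<subset> x" if "xs \<in> W" for xs
      using g that ij G[OF jk] by auto
    have "\<exists>xs\<in>W. g xs \<notin> {y \<in> F. \<not> Q (insert y A)} \<and>
      (\<forall>z\<in>A. \<not> z \<subseteq> g xs \<and> (g xs \<subseteq> z \<longrightarrow> x \<subseteq> z))"
    proof (rule chain_step_down[where U = ?U and l = l and s = s and c = c])
      show "x \<subseteq> ?U" using xF F by blast
      show "g xs \<in> prefixes xs \<and> g xs \<subset> x \<and> l \<le> card (x - g xs) \<and>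
        card x \<le> card (g xs) + s \<and> l \<le> card (g xs)" if "xs \<in> W" for xs
        using gF[OF that] gap[OF _ xF] s[OF _ xF] mid(1)[of "g xs"] mid(2) by auto
      show "z \<subseteq> ?U \<and> card x \<le> card z + s" if "z \<in> A" for z using that A F s[OF _ xF] by blast
      have "real n \<le> 3 * real (card x)" by (rule midr(1)[OF xF])
      thus "card {y \<in> F. \<not> Q (insert y A)} * (l / real (card x)) ^ l +
        2 * real (card A) * (s / real (card x)) < c"
        using small[of A "card x"] A x by auto
    qed (use W A finF finite_subset l in auto)
    then obtain xs where xs: "xs \<in> W" "g xs \<notin> {y \<in> F. \<not> Q (insert y A)}"
      "\<forall>z\<in>A. \<not> z \<subseteq> g xs \<and> (g xs \<subseteq> z \<longrightarrow> x \<subseteq> z)"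
      by (elim bexE conjE)
    moreover have "Q (insert (g xs) A)" using xs(2) gF(1)[OF xs(1)] by simp
    ultimately show "\<exists>y\<in>G j. Q (insert y A) \<and> y \<subset> x \<and> (\<forall>z\<in>A. \<not> z \<subseteq> y \<and> (y \<subseteq> z \<longrightarrow> x \<subseteq> z))"
      using gF(2,4)[OF xs(1)] by (intro bexI[of _ "g xs"] conjI)
  qed
qed

section \<open>Sizes in the middle layers, the extremal collection and the constants\<close>

lemma Btilde_bounds:
  assumes x: "x \<in> Btilde n" and le: "12 * sqrt (real n * ln (real n)) \<le> real n"
  shows "n \<le> 3 * card x" "3 * card x \<le> 2 * n"
proof -
  have "\<bar>real (card x) - real n / 2\<bar> < 2 * sqrt (real n * ln (real n))"
    using x by (simp add: Btilde_def)
  hence "real n \<le> real (3 * card x)" "real (3 * card x) \<le> real (2 * n)" using le by auto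
  thus "n \<le> 3 * card x" "3 * card x \<le> 2 * n" by (simp_all only: of_nat_le_iff)
qed

lemma Btilde_card_diff:
  assumes "x \<in> Btilde n" "y \<in> Btilde n"
  shows "card y \<le> card x + nat \<lfloor>4 * sqrt (real n * ln (real n))\<rfloor>"
proof -
  have "\<bar>real (card x) - real n / 2\<bar> < 2 * sqrt (real n * ln (real n))"
    "\<bar>real (card y) - real n / 2\<bar> < 2 * sqrt (real n * ln (real n))"
    using assms by (auto simp: Btilde_def)
  hence "real_of_int (int (card y) - int (card x)) \<le> 4 * sqrt (real n * ln (real n))" by simp
  hence "int (card y) - int (card x) \<le> \<lfloor>4 * sqrt (real n * ln (real n))\<rfloor>" by (simp only: le_floor_iff)
  thus ?thesis by linarith
qed

text \<open>Of the surplus \<open>2 * e\<close>, one half pays for discarding saturated vertices and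
  the other is left for the embedding. The factor \<open>2 ^ card V\<close> in \<open>bound\<close>
  counts the subsets of the embedded part that a new vertex might saturate.\<close>

lemma balanced_supersaturation:
  fixes e \<delta> \<Delta> :: real
  assumes T: "tree_poset V lt" and e: "e > 0" and l: "l \<ge> 1" and n: "n > 0"
    and F: "F \<subseteq> Pow {1..n}" "gapped l F"
    and mid: "\<And>x. x \<in> F \<Longrightarrow> n \<le> 3 * card x \<and> 3 * card x \<le> 2 * n" "3 * l \<le> n"
    and s: "\<And>x y. x \<in> F \<Longrightarrow> y \<in> F \<Longrightarrow> card y \<le> card x + s"
    and large: "(real (height V lt) - 1 + 2 * e) * (n choose (n div 2)) \<le> card F"
    and \<Delta>: "\<Delta> \<ge> 2" and \<delta>: "2 * real (card V) * \<delta> \<le> e"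
    and bound: "2 ^ card V * (2 * real (card V) * \<Delta>) * (3 * real l / real n) ^ l
      + 2 * real (card V) * (3 * real s / real n)
      < e / (2 * real (height V lt) * (real (height V lt) - 1 + e))"
  shows "\<exists>H. (\<forall>h\<in>H. induced_copy V lt F h) \<and>
    real (card H) \<ge> \<delta> * \<Delta> ^ (card V - 1) * real (n choose (n div 2)) \<and>
    (\<forall>j. 1 \<le> j \<and> j \<le> card V \<longrightarrow>
      (\<forall>D\<subseteq>F. card D = j \<longrightarrow> real (hdeg H D) \<le> \<Delta> ^ (card V - j)))"
proof -
  define m where "m = card V"
  define b where "b = real (n choose (n div 2))"
  define adm where "adm H \<longleftrightarrow> (\<forall>h\<in>H. induced_copy V lt F h) \<and>
    (\<forall>j. 1 \<le> j \<and> j \<le> m \<longrightarrow> (\<forall>D\<subseteq>F. card D = j \<longrightarrow> real (hdeg H D) \<le> \<Delta> ^ (m - j)))" for H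
  have P: "strict_poset_on V lt" and ne: "V \<noteq> {}"
    using T by (auto simp: tree_poset_def hasse_connected_def)
  have finV: "finite V" using P by (simp add: strict_poset_on_def)
  have m: "m \<ge> 1" using finV ne by (simp add: m_def card_gt_0_iff Suc_leI)
  have finF: "finite F" using F(1) by (rule finite_subset) simp
  have copy: "h \<subseteq> F \<and> finite h \<and> card h = m" if "induced_copy V lt F h" for h
    using that finV by (auto simp: induced_copy_def m_def card_image)
  have adm_sub: "H \<subseteq> Pow F" if "adm H" for H
  proof
    fix h assume "h \<in> H"
    hence "induced_copy V lt F h" using that by (simp add: adm_def)
    thus "h \<in> Pow F" using copy by blast
  qed
  have adm_bound: "card H \<le> card (Pow F)" if "adm H" for H
    using adm_sub[OF that] finF by (intro card_mono) auto
  have "adm {}" using \<Delta> by (auto simp: adm_def hdeg_def)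
  then obtain H where H: "adm H" and max: "\<And>H'. adm H' \<Longrightarrow> card H' \<le> card H"
    using ex_has_greatest_nat[of adm "{}" card "Suc (card (Pow F))"] adm_bound
    by (auto simp: less_Suc_eq_le)
  have Hc: "induced_copy V lt F h" if "h \<in> H" for h using H that by (simp add: adm_def)
  have finH: "finite H"
    by (rule finite_subset[OF adm_sub[OF H]]) (use finF in simp)
  have Hdeg: "real (hdeg H D) \<le> \<Delta> ^ (m - card D)" if "D \<subseteq> F" "D \<noteq> {}" "card D \<le> m" for D
  proof -
    have "card D \<ge> 1" using that finF by (simp add: Suc_leI card_gt_0_iff finite_subset)
    thus ?thesis using H that unfolding adm_def by blast
  qed
  have "real (card H) \<ge> \<delta> * \<Delta> ^ (m - 1) * b"
  proof (rule ccontr)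
    assume few: "\<not> ?thesis"
    \<comment> \<open>Every nonempty subset of \<open>A\<close> has room for one more edge. The
      empty set is excluded: its degree is \<open>card H\<close>, which no degree condition
      bounds.\<close>
    define Q where "Q A \<longleftrightarrow> (\<forall>D\<subseteq>A. D \<noteq> {} \<longrightarrow> real (hdeg H D) + 1 \<le> \<Delta> ^ (m - card D))" for A
    have QD: "real (hdeg H D) + 1 \<le> \<Delta> ^ (m - card D)" if "Q A" "D \<subseteq> A" "D \<noteq> {}" for A D
      using that by (simp add: Q_def)
    define S where "S = {x \<in> F. \<not> Q {x}}"
    define F' where "F' = F - S"
    have sub: "F' \<subseteq> F" by (auto simp: F'_def)
    have H': "\<And>h. h \<in> H \<Longrightarrow> finite h \<and> card h = m" using Hc copy by blast
    \<comment> \<open>Double counting with \<open>A = {}\<close>, whose degree is the number of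
      edges; \<open>few\<close> bounds it with \<open>X = \<delta> * b\<close>.\<close>
    have "real (card S) \<le> 2 * real m * (\<delta> * b)"
    proof (rule card_saturated_extensions[where H = H and p = "m - 1" and A = "{}", OF finH H' _ _ \<Delta>])
      show "finite S" using finF by (simp add: S_def)
      show "\<Delta> ^ (m - 1) < real (hdeg H {y}) + 1" if "y \<in> S" for y
        using that by (auto simp: S_def Q_def subset_singleton_iff)
      show "real (hdeg H {}) \<le> \<delta> * b * \<Delta> ^ (m - 1)" using few by (simp add: hdeg_def mult_ac)
    qed
    also have "\<dots> = (2 * real m * \<delta>) * b" by simp
    also have "\<dots> \<le> e * b" using \<delta> by (intro mult_right_mono) (auto simp: m_def b_def)
    finally have "(real (height V lt) - 1 + e) * b \<le> real (card F) - card S"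
      using large by (simp add: b_def algebra_simps)
    also have "\<dots> = card F'"
      using finF by (simp add: F'_def S_def card_Diff_subset of_nat_diff card_mono)
    finally have large': "(real (height V lt) - 1 + e) * (n choose (n div 2)) \<le> card F'"
      by (simp add: b_def)
    have "\<exists>f. inj_on f V \<and> f ` V \<subseteq> F' \<and> Q (f ` V) \<and> (\<forall>x\<in>V. \<forall>y\<in>V. f x \<subset> f y \<longleftrightarrow> lt x y)"
    proof (rule induced_copy_avoiding[OF T e l n _ _ _ mid(2) _ large' _ _ bound])
      show "F' \<subseteq> Pow {1..n}" using sub F by blast
      show "gapped l F'" using F(2) sub unfolding gapped_def by blast
      show "n \<le> 3 * card x \<and> 3 * card x \<le> 2 * n" if "x \<in> F'" for x using mid(1) sub that by blast
      show "card y \<le> card x + s" if "x \<in> F'" "y \<in> F'" for x y using s sub that by blast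
      show "Q {x}" if "x \<in> F'" for x using that by (auto simp: F'_def S_def)
      show "real (card {y \<in> F'. \<not> Q (insert y A)}) \<le> 2 ^ card V * (2 * real (card V) * \<Delta>)"
        if A: "A \<subseteq> F'" "Q A" "A \<noteq> {}" "card A < card V" for A
      proof -
        define Y where "Y B = {y \<in> F'. y \<notin> B \<and> \<Delta> ^ (m - card (insert y B)) < real (hdeg H (insert y B)) + 1}" for B
        let ?N = "{B. B \<subseteq> A \<and> B \<noteq> {}}"
        have finA: "finite A" using A sub finF by (meson finite_subset)
        \<comment> \<open>A saturated \<open>D\<close> inside \<open>insert y A\<close> contains
          \<open>y\<close> because \<open>Q A\<close> holds, and differs from \<open>{y}\<close>
          because saturated vertices were discarded. So \<open>D\<close> is
          \<open>insert y B\<close> for a nonempty \<open>B \<subseteq> A\<close>.\<close>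
        have "{y \<in> F'. \<not> Q (insert y A)} \<subseteq> (\<Union>B\<in>?N. Y B)"
        proof
          fix y assume "y \<in> {y \<in> F'. \<not> Q (insert y A)}"
          then obtain D where y: "y \<in> F'" and D: "D \<subseteq> insert y A" "D \<noteq> {}"
            "\<Delta> ^ (m - card D) < real (hdeg H D) + 1"
            unfolding Q_def by (auto simp: not_le)
          have "y \<in> D" using D A(2) unfolding Q_def by (metis not_le subset_insert)
          hence ins: "insert y (D - {y}) = D" by blast
          have "D \<noteq> {y}"
          proof
            assume "D = {y}"
            moreover have "Q {y}" using y by (simp add: F'_def S_def)
            ultimately have "real (hdeg H D) + 1 \<le> \<Delta> ^ (m - card D)"
              using QD[of "{y}" D] D(2) by simp
            thus False using D(3) by simp
          qed
          hence "D - {y} \<in> ?N" using D \<open>y \<in> D\<close> by blast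
          moreover have "y \<in> Y (D - {y})" using y D(3) by (simp only: Y_def mem_Collect_eq ins) simp
          ultimately show "y \<in> (\<Union>B\<in>?N. Y B)" by blast
        qed
        moreover have finN: "finite ?N" using finA by simp
        moreover have finY: "finite (Y B)" for B
          using sub finF by (intro finite_subset[of "Y B" F]) (auto simp: Y_def)
        ultimately have "card {y \<in> F'. \<not> Q (insert y A)} \<le> card (\<Union>B\<in>?N. Y B)"
          by (intro card_mono) auto
        also have "\<dots> \<le> (\<Sum>B\<in>?N. card (Y B))" by (rule card_UN_le[OF finN])
        finally have "real (card {y \<in> F'. \<not> Q (insert y A)}) \<le> real (\<Sum>B\<in>?N. card (Y B))"
          by (rule of_nat_mono)
        also have "\<dots> = (\<Sum>B\<in>?N. real (card (Y B)))" by (rule of_nat_sum)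
        also have "\<dots> \<le> (\<Sum>B\<in>?N. 2 * real m * \<Delta>)"
        proof (rule sum_mono)
          fix B assume B: "B \<in> ?N"
          have cB: "card B < m" using B finA A(4) card_mono[of A B] by (simp add: m_def)
          have fB: "finite B" using B finA finite_subset by blast
          show "real (card (Y B)) \<le> 2 * real m * \<Delta>"
          proof (rule card_saturated_extensions[where H = H and p = "m - card B - 1" and A = B,
                OF finH H' finY _ \<Delta>])
            show "\<Delta> ^ (m - card B - 1) < real (hdeg H (insert y B)) + 1" if "y \<in> Y B" for y
              using that fB by (auto simp: Y_def)
            \<comment> \<open>The degree bound for \<open>B\<close> has one factor
              \<open>\<Delta>\<close> more than the saturation threshold of
              \<open>insert y B\<close>, so \<open>X = \<Delta>\<close>.\<close>
            have "real (hdeg H B) \<le> \<Delta> ^ (m - card B)"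
              using B A(1) sub cB by (intro Hdeg) auto
            also have "m - card B = Suc (m - card B - 1)" using cB by simp
            finally show "real (hdeg H B) \<le> \<Delta> * \<Delta> ^ (m - card B - 1)" by simp
          qed
        qed
        also have "\<dots> = card ?N * (2 * real m * \<Delta>)" by simp
        also have "\<dots> \<le> 2 ^ m * (2 * real m * \<Delta>)"
        proof (rule mult_right_mono)
          have "card ?N \<le> card (Pow A)" using finA by (intro card_mono) auto
          also have "\<dots> \<le> 2 ^ m" using finA A(4) by (simp add: card_Pow m_def)
          finally have "real (card ?N) \<le> real (2 ^ m)" by (rule of_nat_mono)
          thus "real (card ?N) \<le> 2 ^ m" by simp
        qed (use \<Delta> in simp)
        finally show ?thesis by (simp add: m_def)
      qed
    qed
    then obtain f where f: "inj_on f V" "f ` V \<subseteq> F'" "Q (f ` V)"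
      "\<forall>x\<in>V. \<forall>y\<in>V. f x \<subset> f y \<longleftrightarrow> lt x y" by blast
    define h where "h = f ` V"
    have h: "induced_copy V lt F h" unfolding induced_copy_def h_def using f sub by blast
    have ch: "card h = m" "h \<noteq> {}" using f(1) ne by (auto simp: h_def m_def card_image)
    have Qh: "real (hdeg H D) + 1 \<le> \<Delta> ^ (m - card D)" if "D \<subseteq> h" "D \<noteq> {}" for D
      using f(3) that by (simp add: Q_def h_def)
    \<comment> \<open>For \<open>D = h\<close> the exponent is 0, so having room means degree zero,
      whereas a member of \<open>H\<close> is counted in its own degree.\<close>
    have "h \<notin> H"
    proof
      assume "h \<in> H"
      hence "card {g \<in> H. h \<subseteq> g} > 0" using finH by (auto simp: card_gt_0_iff)
      thus False using Qh[of h] ch by (simp add: hdeg_def)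
    qed
    moreover have "adm (insert h H)"
      unfolding adm_def
    proof (intro conjI allI impI ballI)
      show "induced_copy V lt F g" if "g \<in> insert h H" for g using that h Hc by blast
      fix j D assume j: "1 \<le> j \<and> j \<le> m" and D: "D \<subseteq> F" "card D = j"
      have D0: "D \<noteq> {}" using j D by auto
      have "real (hdeg (insert h H) D) \<le> real (hdeg H D) + (if D \<subseteq> h then 1 else 0)"
        using hdeg_insert_le[OF finH, of h D] by (auto split: if_splits)
      \<comment> \<open>Subsets of \<open>h\<close> had room for one more edge; all other degrees
        are unchanged.\<close>
      also have "\<dots> \<le> \<Delta> ^ (m - j)"
        using Qh[of D] Hdeg[of D] D D0 j by auto
      finally show "real (hdeg (insert h H) D) \<le> \<Delta> ^ (m - j)" .
    qed
    ultimately show False using max[of "insert h H"] finH by simp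
  qed
  thus ?thesis using H unfolding adm_def m_def b_def by blast
qed

theorem theorem5p5:
  fixes V :: "'p set" and lt :: "'p \<Rightarrow> 'p \<Rightarrow> bool" and \<epsilon> :: real and l :: nat
  assumes "tree_poset V lt" and "\<epsilon> > 0" and "l \<ge> 1"
  shows "\<exists>\<delta>::real. \<delta> > 0 \<and> (\<exists>N::nat. \<forall>n \<ge> N. \<forall>\<F>.
     \<F> \<subseteq> Btilde n \<and> gapped l \<F> \<and>
     real (card \<F>) \<ge> (real (height V lt) - 1 + \<epsilon>) * real (n choose (n div 2)) \<longrightarrow>
     (\<exists>H. (\<forall>h\<in>H. induced_copy V lt \<F> h) \<and>
        real (card H) \<ge> \<delta> ^ card V * real n ^ (l * (card V - 1)) * real (n choose (n div 2)) \<and>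
        (\<forall>j. 1 \<le> j \<and> j \<le> card V \<longrightarrow>
           (\<forall>D \<subseteq> \<F>. card D = j \<longrightarrow> real (hdeg H D) \<le> (\<delta> * real n ^ l) ^ (card V - j)))))"
proof -
  define m where "m = card V"
  define k where "k = height V lt"
  \<comment> \<open>Makes the surplus \<open>2 * e\<close> equal to
    \<open>\<epsilon>\<close>.\<close>
  define e where "e = \<epsilon> / 2"
  define c where "c = e / (2 * real k * (real k - 1 + e))"
  \<comment> \<open>With \<open>\<Delta> = \<delta> * n ^ l\<close> the powers of \<open>n\<close>
    cancel, and the saturation term of the union bound is \<open>K * \<delta>\<close>.\<close>
  define K where "K = 2 ^ m * (2 * real m) * (3 * real l) ^ l"
  \<comment> \<open>The first entry limits the discarded vertices to the share \<open>e\<close>; the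
    second makes \<open>K * \<delta>\<close> at most a quarter of \<open>c\<close>.\<close>
  define \<delta> where "\<delta> = min (e / (2 * real m)) (c / (4 * K))"
  have P: "strict_poset_on V lt" and ne: "V \<noteq> {}"
    using assms(1) by (auto simp: tree_poset_def hasse_connected_def)
  have finV: "finite V" using P by (simp add: strict_poset_on_def)
  have m: "m \<ge> 1" using finV ne by (simp add: m_def card_gt_0_iff Suc_leI)
  have k: "k \<ge> 1"
  proof -
    obtain r x where "x \<in> V" "(r x :: nat) < height V lt" using strict_poset_rank[OF P] ne by blast
    thus ?thesis by (simp add: k_def)
  qed
  have e: "e > 0" using assms(2) by (simp add: e_def)
  have c: "c > 0" using e k by (simp add: c_def)
  have K: "K > 0" using m assms(3) by (simp add: K_def)
  have \<delta>: "\<delta> > 0" "2 * real m * \<delta> \<le> e" "K * \<delta> \<le> c / 4"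
  proof -
    show "\<delta> > 0" using e m c K by (simp add: \<delta>_def)
    have "\<delta> \<le> e / (2 * real m)" "\<delta> \<le> c / (4 * K)" by (auto simp: \<delta>_def)
    thus "2 * real m * \<delta> \<le> e" "K * \<delta> \<le> c / 4" using m K by (simp_all add: field_simps)
  qed
  \<comment> \<open>\<open>1 / 12\<close> places all sizes in the middle third. The other entry
    bounds the comparability term, which is at most \<open>24 * m * \<eta>\<close> as
    \<open>s \<le> 4 * \<eta> * n\<close>, by a quarter of \<open>c\<close>.\<close>
  define \<eta> where "\<eta> = min (1 / 12) (c / (96 * real m))"
  have \<eta>: "\<eta> > 0" "12 * \<eta> \<le> 1" "24 * real m * \<eta> \<le> c / 4"
  proof -
    show "\<eta> > 0" "12 * \<eta> \<le> 1" using c m by (auto simp: \<eta>_def)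
    have "\<eta> \<le> c / (96 * real m)" by (auto simp: \<eta>_def)
    thus "24 * real m * \<eta> \<le> c / 4" using m by (simp add: field_simps)
  qed
  obtain N\<^sub>0 where N\<^sub>0: "\<And>n. n \<ge> N\<^sub>0 \<Longrightarrow> sqrt (real n * ln (real n)) \<le> \<eta> * real n"
    using eventually_sqrt_ln_small[OF \<eta>(1)] unfolding eventually_sequentially by blast
  \<comment> \<open>\<open>2 / \<delta> \<le> n\<close> gives \<open>\<Delta> \<ge> 2\<close>;
    \<open>3 * l \<le> n\<close> leaves room for a gap of \<open>l\<close> beyond the middle
    third.\<close>
  define N where "N = max N\<^sub>0 (max (3 * l) (nat \<lceil>2 / \<delta>\<rceil>))"
  show ?thesis
  proof (intro exI[of _ \<delta>] conjI exI[of _ N] allI impI)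
    show "\<delta> > 0" by (rule \<delta>)
    fix n \<F>
    assume nN: "n \<ge> N" and "\<F> \<subseteq> Btilde n \<and> gapped l \<F> \<and>
      real (card \<F>) \<ge> (real (height V lt) - 1 + \<epsilon>) * real (n choose (n div 2))"
    hence F: "\<F> \<subseteq> Btilde n" "gapped l \<F>"
      and large: "real (card \<F>) \<ge> (real (height V lt) - 1 + \<epsilon>) * real (n choose (n div 2))"
      by auto
    define s where "s = nat \<lfloor>4 * sqrt (real n * ln (real n))\<rfloor>"
    define \<Delta> where "\<Delta> = \<delta> * real n ^ l"
    have n3: "3 * l \<le> n" and n\<delta>: "2 / \<delta> \<le> real n" using nN by (auto simp: N_def)
    have n0: "n > 0" using n3 assms(3) by simp
    have sq: "sqrt (real n * ln (real n)) \<le> \<eta> * real n" using N\<^sub>0 nN by (simp add: N_def)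
    hence sq12: "12 * sqrt (real n * ln (real n)) \<le> real n"
      using mult_right_mono[OF \<eta>(2), of "real n"] by simp
    have "sqrt (real n * ln (real n)) \<ge> 0" using n0 by simp
    hence s: "real s \<le> 4 * (\<eta> * real n)" using sq unfolding s_def by linarith
    have "real n ^ 1 \<le> real n ^ l" using n0 assms(3) by (intro power_increasing) auto
    hence "\<delta> * real n \<le> \<Delta>" using \<delta> by (simp add: \<Delta>_def)
    moreover have "2 \<le> \<delta> * real n" using n\<delta> \<delta> by (simp add: field_simps)
    ultimately have \<Delta>: "\<Delta> \<ge> 2" by linarith
    have "2 ^ m * (2 * real m * \<Delta>) * (3 * real l / real n) ^ l = K * \<delta>"
      using n0 by (simp add: K_def \<Delta>_def power_divide)
    moreover have "2 * real m * (3 * real s / real n) \<le> c / 4"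
    proof -
      have "3 * real s / real n \<le> 12 * \<eta>" using s n0 by (simp add: field_simps)
      hence "2 * real m * (3 * real s / real n) \<le> 2 * real m * (12 * \<eta>)" by (intro mult_left_mono) auto
      thus ?thesis using \<eta>(3) by simp
    qed
    ultimately have bound: "2 ^ card V * (2 * real (card V) * \<Delta>) * (3 * real l / real n) ^ l
      + 2 * real (card V) * (3 * real s / real n)
      < e / (2 * real (height V lt) * (real (height V lt) - 1 + e))"
      using \<delta>(3) c unfolding m_def[symmetric] k_def[symmetric] c_def[symmetric] by linarith
    have "\<exists>H. (\<forall>h\<in>H. induced_copy V lt \<F> h) \<and>
      real (card H) \<ge> \<delta> * \<Delta> ^ (card V - 1) * real (n choose (n div 2)) \<and>
      (\<forall>j. 1 \<le> j \<and> j \<le> card V \<longrightarrow>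
        (\<forall>D\<subseteq>\<F>. card D = j \<longrightarrow> real (hdeg H D) \<le> \<Delta> ^ (card V - j)))"
    proof (rule balanced_supersaturation[OF assms(1) e assms(3) n0 _ F(2) _ n3 _ _ \<Delta> _ bound])
      show "\<F> \<subseteq> Pow {1..n}" using F(1) by (auto simp: Btilde_def)
      show "n \<le> 3 * card x \<and> 3 * card x \<le> 2 * n" if "x \<in> \<F>" for x
        using Btilde_bounds[OF _ sq12] F(1) that by blast
      show "card y \<le> card x + s" if "x \<in> \<F>" "y \<in> \<F>" for x y
        unfolding s_def using F(1) that by (intro Btilde_card_diff) auto
      show "(real (height V lt) - 1 + 2 * e) * (n choose (n div 2)) \<le> card \<F>"
        using large by (simp add: e_def)
      show "2 * real (card V) * \<delta> \<le> e" using \<delta>(2) by (simp add: m_def)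
    qed
    \<comment> \<open>The extra factor \<open>\<delta>\<close> in the size bound completes the power
      \<open>\<delta> ^ card V\<close>.\<close>
    moreover have "\<delta> * \<Delta> ^ (card V - 1) = \<delta> ^ card V * real n ^ (l * (card V - 1))"
      using m by (simp add: \<Delta>_def power_mult_distrib power_mult m_def flip: power_Suc)
    ultimately show "\<exists>H. (\<forall>h\<in>H. induced_copy V lt \<F> h) \<and>
        real (card H) \<ge> \<delta> ^ card V * real n ^ (l * (card V - 1)) * real (n choose (n div 2)) \<and>
        (\<forall>j. 1 \<le> j \<and> j \<le> card V \<longrightarrow>
           (\<forall>D \<subseteq> \<F>. card D = j \<longrightarrow> real (hdeg H D) \<le> (\<delta> * real n ^ l) ^ (card V - j)))"
      by (simp add: \<Delta>_def)
  qed
qed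

end
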